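(* Let $B:=(2,\{00,11\})$, that is, $B$ is the pattern consisting of two isolated loops. Then $\lambda_{5,4}=5/8$, the $(5,4)$-edge-inducibility problem is perfectly $B$-stable, and the unique maximizer of $\lambda_{5,4}(B(\mathbf{a}))$ over $\mathbf{a}\in\mathbb{S}_2$ is $\mathbf{a}=(1/2,1/2)$.
   Context: Graphs are finite and simple. $[m]:=\{0,\dots,m-1\}$, $ij$ abbreviates the unordered pair $\{i,j\}$ (with $ii$ denoting a loop at $i$), and $(m,E)$ denotes the graph/pattern with vertex set $[m]$ and edge set $E$. Edge-inducibility: for non-negative integers $\kappa,\ell$ and a graph $G$ with $n\ge\kappa$ vertices, $\lambda_{\kappa,\ell}(G)$ is the number of $\kappa$-subsets of $V(G)$ that span exactly $\ell$ edges of $G$, divided by $\binom{n}{\kappa}$. Further, $\lambda_{\kappa,\ell}(n):=\max\{\lambda_{\kappa,\ell}(G): G \text{ is an } n\text{-vertex graph}\}$ and $\lambda_{\kappa,\ell}:=\lim_{n\to\infty}\lambda_{\kappa,\ell}(n)$ (the limit exists). A pattern $B$ is a graph in which loops on some vertices are additionally allowed (no multiple edges). A pattern automorphism is a bijection $f:V(B)\to V(B)$ such that for all $u,w\in V(B)$ (including $u=w$) $\{u,w\}\in E(B)$ iff $\{f(u),f(w)\}\in E(B)$. For a pattern $B$ with vertex set $[m]$ and pairwise disjoint finite sets $V_0,\dots,V_{m-1}$ (some possibly empty), the blowup $B(V_0,\dots,V_{m-1})$ is the (loopless) graph on $V_0\cup\dots\cup V_{m-1}$ in which distinct $x\in V_i$,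 $y\in V_j$ are adjacent iff $\{i,j\}\in E(B)$ (so $V_i$ is a clique if $i$ has a loop, and an independent set otherwise). $B()$ denotes the family of all blowups of $B$. $\mathbb{S}_m:=\{(x_0,\dots,x_{m-1})\in\mathbb{R}^m: x_0+\dots+x_{m-1}=1,\ x_i\ge 0 \text{ for all } i\}$. For $\mathbf{x}\in\mathbb{S}_m$, $\lambda_{\kappa,\ell}(B(\mathbf{x}))$ is the limit as $n\to\infty$ of $\lambda_{\kappa,\ell}(B(V_0,\dots,V_{m-1}))$ where $|V_i|=(x_i+o(1))n$ for each $i\in[m]$. A maximizer is an $\mathbf{x}\in\mathbb{S}_m$ at which this function attains its maximum over $\mathbb{S}_m$. The edit distance $\delta_{\mathrm{edit}}(G,H)$ between graphs of the same order is the minimum of $|E(G)\bigtriangleup f(E(H))|$ over bijections $f:V(H)\to V(G)$, and $\delta_{\mathrm{edit}}(G,B())$ is the minimum of $\delta_{\mathrm{edit}}(G,H)$ over $H\in B()$ with the same number of vertices as $G$. The $(\kappa,\ell)$-problem is perfectly $B$-stable if there is $C>0$ such that every graph $G$ of order $n\ge C$ satisfies $\delta_{\mathrm{edit}}(G,B())\le C\,(\lambda_{\kappa,\ell}(n)-\lambda_{\kappa,\ell}(G))\,n^2$. *)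

theory Defs
  imports Complex_Main "HOL-Library.Disjoint_Sets"
begin

text \<open>
  Edges are sets of vertices. A loop at \<open>i\<close> is the singleton \<open>{i, i} = {i}\<close>, so the same
  record serves for graphs (all edges of cardinality 2) and for patterns (cardinality 1 or 2).
\<close>

record 'a graph =
  verts :: "'a set"
  edges :: "'a set set"

definition simple_graph :: "'a graph \<Rightarrow> bool" where
  "simple_graph G \<longleftrightarrow> finite (verts G) \<and> (\<forall>e\<in>edges G. e \<subseteq> verts G \<and> card e = 2)"

definition graph_on :: "nat \<Rightarrow> nat set set \<Rightarrow> nat graph" where
  "graph_on m E = \<lparr>verts = {..<m}, edges = E\<rparr>"

definition density :: "nat \<Rightarrow> nat \<Rightarrow> 'a graph \<Rightarrow> real" where
  "density k l G =
     real (card {S. S \<subseteq> verts G \<and> card S = k \<and> card {e \<in> edges G. e \<subseteq> S} = l})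
       / real (card (verts G) choose k)"

text \<open>
  Graphs on finite sets of natural numbers represent all finite graphs up to isomorphism.
  The set below is finite, as the densities of graphs of order \<open>n\<close> have a common denominator.
\<close>

definition max_density :: "nat \<Rightarrow> nat \<Rightarrow> nat \<Rightarrow> real" where
  "max_density k l n =
     Max {density k l G | G :: nat graph. simple_graph G \<and> card (verts G) = n}"

definition inducibility :: "nat \<Rightarrow> nat \<Rightarrow> real" where
  "inducibility k l = lim (\<lambda>n. max_density k l n)"

definition valid_parts :: "'b graph \<Rightarrow> ('b \<Rightarrow> 'a set) \<Rightarrow> bool" where
  "valid_parts B V \<longleftrightarrow> (\<forall>i\<in>verts B. finite (V i)) \<and> disjoint_family_on V (verts B)"

definition blowup :: "'b graph \<Rightarrow> ('b \<Rightarrow> 'a set) \<Rightarrow> 'a graph" where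
  "blowup B V =
     \<lparr>verts = (\<Union>i\<in>verts B. V i),
      edges = {{x, y} | x y. x \<noteq> y \<and>
        (\<exists>i\<in>verts B. \<exists>j\<in>verts B. x \<in> V i \<and> y \<in> V j \<and> {i, j} \<in> edges B)}\<rparr>"

definition blowups :: "'b graph \<Rightarrow> 'a graph set" where
  "blowups B = {blowup B V | V. valid_parts B V}"

text \<open>Vectors \<open>(x\<^sub>0, \<dots>, x\<^sub>m\<^sub>-\<^sub>1)\<close> are lists of length \<open>m\<close>.\<close>

definition simplex :: "nat \<Rightarrow> real list set" where
  "simplex m = {x. length x = m \<and> sum_list x = 1 \<and> (\<forall>i<m. x ! i \<ge> 0)}"

text \<open>
  For a pattern \<open>B\<close> with vertex set \<open>{..<m}\<close>: the common limit of the densities along all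
  sequences of blowups whose part sizes satisfy \<open>\<bar>V\<^sub>i\<bar> = (x\<^sub>i + o(1)) n\<close>.
\<close>

definition blowup_density :: "nat \<Rightarrow> nat \<Rightarrow> nat graph \<Rightarrow> real list \<Rightarrow> real" where
  "blowup_density k l B x =
     (THE L. \<forall>V :: nat \<Rightarrow> nat \<Rightarrow> nat set.
        (\<forall>n. valid_parts B (V n)) \<longrightarrow>
        (\<forall>i\<in>verts B. (\<lambda>n. real (card (V n i)) / real n) \<longlonglongrightarrow> x ! i) \<longrightarrow>
        (\<lambda>n. density k l (blowup B (V n))) \<longlonglongrightarrow> L)"

definition maximizers :: "nat \<Rightarrow> nat \<Rightarrow> nat graph \<Rightarrow> real list set" where
  "maximizers k l B =
     {x. is_arg_max (blowup_density k l B) (\<lambda>y. y \<in> simplex (card (verts B))) x}"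

definition edit_dist :: "'a graph \<Rightarrow> 'b graph \<Rightarrow> nat" where
  "edit_dist G H =
     (LEAST d. \<exists>f. bij_betw f (verts H) (verts G) \<and>
        d = card (sym_diff (edges G) ((\<lambda>e. f ` e) ` edges H)))"

definition edit_dist_blowups :: "'a graph \<Rightarrow> 'b graph \<Rightarrow> nat" where
  "edit_dist_blowups G B =
     (LEAST d. \<exists>H :: 'a graph. H \<in> blowups B \<and> card (verts H) = card (verts G) \<and>
        d = edit_dist G H)"

definition perfectly_stable :: "nat \<Rightarrow> nat \<Rightarrow> 'b graph \<Rightarrow> bool" where
  "perfectly_stable k l B \<longleftrightarrow>
     (\<exists>C::real. C > 0 \<and>
        (\<forall>G :: nat graph. simple_graph G \<longrightarrow> real (card (verts G)) \<ge> C \<longrightarrow>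
           real (edit_dist_blowups G B) \<le>
             C * (max_density k l (card (verts G)) - density k l G) * (real (card (verts G)))\<^sup>2))"

end

theory Submission
  imports Defs "HOL-Combinatorics.Multiset_Permutations" "HOL-Real_Asymp.Real_Asymp"
begin

text \<open>
  Call a triple bad if it spans an even number of edges. A graph without bad triples is a
  disjoint union of two cliques, and if \<open>T\<close> ordered triples are bad, then for some vertex
  \<open>v\<close> the two cliques on the closed neighbourhood of \<open>v\<close> and on its complement differ from the
  graph in at most \<open>T / n\<close> ordered pairs.

  So it suffices to bound the number of five-sets with four edges by its value for two balanced
  cliques minus a multiple of \<open>n\<^sup>2 T\<close>. This comes from a flag algebra certificate on five vertices.
  The sums run over 5-tuples with repetition, a vertex being adjacent to itself, so that the squares
  in the certificate are exact. Comparing with the two cliques \<open>H\<close> around \<open>v\<close>, all lower-order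
  terms (squares, degenerate tuples) change by \<open>O((1 + \<bar>m\<bar>) n T)\<close> only, where \<open>m\<close> is the difference
  of the clique sizes. This settles small \<open>\<bar>m\<bar>\<close>; for \<open>\<bar>m\<bar>\<close> linear in \<open>n\<close>, either \<open>T\<close> or the
  imbalance of \<open>H\<close> costs a constant proportion of all five-sets.
\<close>

section \<open>The flag algebra certificate\<close>

text \<open>
  Flags have a labelled triple and one further vertex, whose adjacencies to the triple are the
  arguments. The values were obtained by rounding a numerical solution of the semidefinite program.
  On disjoint unions of two cliques \<open>edge_flag\<close> and \<open>triangle_flag\<close> measure the imbalance
  of the two parts, and the defect and skew flags vanish.
\<close>

definition triangle_flag :: "bool \<Rightarrow> bool \<Rightarrow> bool \<Rightarrow> int" where
  "triangle_flag a b c = (if a then (if b then of_bool c else if c then 0 else 2)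
     else if b then (if c then 0 else 2) else if c then 2 else -1)"

definition empty_flag :: "bool \<Rightarrow> bool \<Rightarrow> bool \<Rightarrow> int" where
  "empty_flag a b c = (if a then (if b then (if c then 4 else 2) else if c then 2 else -2)
     else if b then (if c then 2 else -2) else if c then -2 else -1)"

definition edge_flag :: "bool \<Rightarrow> bool \<Rightarrow> bool \<Rightarrow> int" where
  "edge_flag a b c = (if a then (if b then (if c then 0 else 2) else if c then 2 else -1)
     else if b then (if c then 2 else -1) else if c then -2 else 0)"

definition edge_defect_flag :: "bool \<Rightarrow> bool \<Rightarrow> bool \<Rightarrow> int" where
  "edge_defect_flag a b c = (if a then (if b then (if c then -8 else 0) else if c then -2 else 1)
     else if b then (if c then -2 else 1) else if c then 0 else 3)"

definition edge_skew_flag :: "bool \<Rightarrow> bool \<Rightarrow> bool \<Rightarrow> int" where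
  "edge_skew_flag a b c = (if a then (if b then 0 else if c then 1 else 2)
     else if b then (if c then -1 else -2) else 0)"

text \<open>The flag on a single edge takes the isolated label as its last argument. Types with
  exactly two edges carry the zero flag; like the empty type, they do not occur on two
  cliques.\<close>

definition main_flag :: "bool \<Rightarrow> bool \<Rightarrow> bool \<Rightarrow> bool \<Rightarrow> bool \<Rightarrow> bool \<Rightarrow> int" where
  "main_flag xy xz yz xu yu zu =
     (if xy then if xz then if yz then triangle_flag xu yu zu else 0 else if yz then 0
         else edge_flag xu yu zu
      else if xz then if yz then 0 else edge_flag xu zu yu
      else if yz then edge_flag yu zu xu else empty_flag xu yu zu)"

text \<open>The skew flag changes sign when the ends of the edge are exchanged. Only products of two
  values on the same type enter the certificate, so any choice of orientation gives the same
  product.\<close>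

definition on_single_edge :: "(bool \<Rightarrow> bool \<Rightarrow> bool \<Rightarrow> int) \<Rightarrow> bool \<Rightarrow> bool \<Rightarrow> bool \<Rightarrow> bool \<Rightarrow> bool \<Rightarrow> bool
    \<Rightarrow> int" where
  "on_single_edge f xy xz yz xu yu zu =
     (if xy then if xz then 0 else if yz then 0 else f xu yu zu
      else if xz then if yz then 0 else f xu zu yu
      else if yz then f yu zu xu else 0)"

text \<open>The weights are 12 for triangles, 7 for single edges and 6 for empty triples. A type
  with two edges shares the branch of another type, as \<open>main_flag\<close> vanishes on
  it.\<close>

definition main_coeff :: "bool \<Rightarrow> bool \<Rightarrow> bool \<Rightarrow> int" where
  "main_coeff xy xz yz = (if xy then if xz then 12 else 7 else if xz then 7 else if yz then 7
      else 6)"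

text \<open>A positive semidefinite form in diagonal shape: summed over \<open>u\<close> and
  \<open>v\<close>, each of the three terms becomes a square with a nonnegative weight.\<close>

definition flag_product :: "bool \<Rightarrow> bool \<Rightarrow> bool \<Rightarrow> bool \<Rightarrow> bool \<Rightarrow> bool \<Rightarrow> bool \<Rightarrow> bool \<Rightarrow> bool
    \<Rightarrow> int" where
  "flag_product xy xz yz xu yu zu xv yv zv =
     main_coeff xy xz yz * (main_flag xy xz yz xu yu zu * main_flag xy xz yz xv yv zv)
     + on_single_edge edge_defect_flag xy xz yz xu yu zu
         * on_single_edge edge_defect_flag xy xz yz xv yv zv
     + 10 * (on_single_edge edge_skew_flag xy xz yz xu yu zu
         * on_single_edge edge_skew_flag xy xz yz xv yv zv)"

definition edge_count :: "bool \<Rightarrow> bool \<Rightarrow> bool \<Rightarrow> bool \<Rightarrow> bool \<Rightarrow> bool \<Rightarrow> bool \<Rightarrow> bool \<Rightarrow> bool \<Rightarrow> bool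
    \<Rightarrow> nat" where
  "edge_count ab ac ad ae bc bd be cd ce de =
     of_bool ab + of_bool ac + of_bool ad + of_bool ae + of_bool bc
     + of_bool bd + of_bool be + of_bool cd + of_bool ce + of_bool de"

text \<open>
  The ten splittings of five vertices into a type and a pair form two orbits under rotation,
  according to whether the pair is cyclically adjacent.
\<close>

definition flag_product_total :: "bool \<Rightarrow> bool \<Rightarrow> bool \<Rightarrow> bool \<Rightarrow> bool \<Rightarrow> bool \<Rightarrow> bool \<Rightarrow> bool \<Rightarrow> bool
    \<Rightarrow> bool \<Rightarrow> int" where
  "flag_product_total ab ac ad ae bc bd be cd ce de =
     flag_product ab ac bc ad bd cd ae be ce + flag_product bc bd cd be ce de ab ac ad
   + flag_product cd ce de ac ad ae bc bd be + flag_product de ad ae bd be ab cd ce ac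
   + flag_product ae be ab ce ac bc de ad bd
   + (flag_product ab ad bd ac bc cd ae be de + flag_product bc be ce bd cd de ab ac ae
   + flag_product cd ac ad ce de ae bc bd ab + flag_product de bd be ad ae ab cd ce bc
   + flag_product ae ce ac be ab bc de ad cd)"

text \<open>All \<open>2 ^ 10\<close> adjacency patterns are evaluated. The first term penalises a
  bad triple \<open>a, b, c\<close>, and \<open>120 = 192 * (5 / 8)\<close> is the target
  density.\<close>

lemma certificate:
  "\<forall>ab ac ad ae bc bd be cd ce de.
     of_bool (ab \<noteq> (ac = bc)) + 192 * of_bool (edge_count ab ac ad ae bc bd be cd ce de = 4)
       + flag_product_total ab ac ad ae bc bd be cd ce de \<le> (120::int)"
  by code_simp

text \<open>Complementary slackness: the certificate is tight on every pattern induced by two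
  cliques, repeated vertices included, so comparing a graph with two cliques leaves no constant
  term.\<close>

lemma certificate_tight:
  "\<forall>a b c d e.
     192 * of_bool (edge_count (a = b) (a = c) (a = d) (a = e) (b = c) (b = d) (b = e) (c = d) (c
         = e) (d = e) = 4)
       + flag_product_total (a = b) (a = c) (a = d) (a = e) (b = c) (b = d) (b = e) (c = d) (c
           = e) (d = (e::bool)) = (120::int)"
  by code_simp

text \<open>Two cliques on five vertices have four edges exactly for a split into 3 and 2; splits
  4+1 and 5+0 give 6 and 10. The right side is \<open>5 - e2 + e4\<close> with elementary symmetric
  polynomials of the signs, which is 8 on the split 3+2 and 0 on the others.\<close>

lemma two_clique_value:
  "\<forall>a b c d e.
     (let s = \<lambda>x. if x then 1 else - 1 in
     8 * of_bool (edge_count (a = b) (a = c) (a = d) (a = e) (b = c) (b = d) (b = e) (c = d) (c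
         = e) (d = e) = 4)
     = 5 - (s a * s b + s a * s c + s a * s d + s a * s e + s b * s c + s b * s d + s b * s e
            + s c * s d + s c * s e + s d * s e)
         + (s a * s b * s c * s d + s a * s b * s c * s e + s a * s b * s d * s e
            + s a * s c * s d * s e + s b * s c * s d * (s (e::bool) :: int)))"
  by code_simp

section \<open>Sums over 5-tuples\<close>

definition sum5 :: "'a set \<Rightarrow> ('a \<Rightarrow> 'a \<Rightarrow> 'a \<Rightarrow> 'a \<Rightarrow> 'a \<Rightarrow> int) \<Rightarrow> int" where
  "sum5 V f = (\<Sum>a\<in>V. \<Sum>b\<in>V. \<Sum>c\<in>V. \<Sum>d\<in>V. \<Sum>e\<in>V. f a b c d e)"

lemma sum5_rotate: "sum5 V (\<lambda>a b c d e. f b c d e a) = sum5 V f"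
proof -
  have "sum5 V (\<lambda>a b c d e. f b c d e a) = (\<Sum>b\<in>V. \<Sum>a\<in>V. \<Sum>c\<in>V. \<Sum>d\<in>V. \<Sum>e\<in>V. f b c d e a)"
    unfolding sum5_def by (rule sum.swap)
  also have "\<dots> = (\<Sum>b\<in>V. \<Sum>c\<in>V. \<Sum>a\<in>V. \<Sum>d\<in>V. \<Sum>e\<in>V. f b c d e a)"
    by (rule sum.cong[OF refl], rule sum.swap)
  also have "\<dots> = (\<Sum>b\<in>V. \<Sum>c\<in>V. \<Sum>d\<in>V. \<Sum>a\<in>V. \<Sum>e\<in>V. f b c d e a)"
    by (rule sum.cong[OF refl], rule sum.cong[OF refl], rule sum.swap)
  also have "\<dots> = sum5 V f"
    unfolding sum5_def by (rule sum.cong[OF refl], rule sum.cong[OF refl], rule sum.cong[OF refl], rule sum.swap)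
  finally show ?thesis .
qed

lemma sum5_swap: "sum5 V (\<lambda>a b c d e. f a b d c e) = sum5 V f"
  unfolding sum5_def by (rule sum.cong[OF refl], rule sum.cong[OF refl], rule sum.swap)

lemma sum5_add: "sum5 V (\<lambda>a b c d e. f a b c d e + g a b c d e) = sum5 V f + sum5 V g"
  by (simp add: sum5_def sum.distrib)

lemma sum5_diff: "sum5 V (\<lambda>a b c d e. f a b c d e - g a b c d e) = sum5 V f - sum5 V g"
  by (simp add: sum5_def sum_subtractf)

lemma sum5_cmult: "sum5 V (\<lambda>a b c d e. k * f a b c d e) = k * sum5 V f"
  by (simp add: sum5_def sum_distrib_left)

lemma sum5_const: "sum5 V (\<lambda>a b c d e. k) = int (card V) ^ 5 * k"
  by (simp add: sum5_def eval_nat_numeral)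

lemma sum5_mono:
  assumes "\<And>a b c d e. \<lbrakk>a \<in> V; b \<in> V; c \<in> V; d \<in> V; e \<in> V\<rbrakk> \<Longrightarrow> f a b c d e \<le> g a b c d e"
  shows "sum5 V f \<le> sum5 V g"
  unfolding sum5_def by (intro sum_mono assms)

lemma sum5_cong:
  assumes "\<And>a b c d e. \<lbrakk>a \<in> V; b \<in> V; c \<in> V; d \<in> V; e \<in> V\<rbrakk> \<Longrightarrow> f a b c d e = g a b c d e"
  shows "sum5 V f = sum5 V g"
  unfolding sum5_def by (intro sum.cong refl assms)

lemma sum5_rotations:
  "sum5 V (\<lambda>a b c d e. f a b c d e + f b c d e a + f c d e a b + f d e a b c + f e a b c d) = 5
      * sum5 V f"
proof -
  have "sum5 V (\<lambda>a b c d e. f b c d e a) = sum5 V f"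
    by (rule sum5_rotate)
  moreover have "sum5 V (\<lambda>a b c d e. f c d e a b) = sum5 V (\<lambda>a b c d e. f b c d e a)"
    by (rule sum5_rotate)
  moreover have "sum5 V (\<lambda>a b c d e. f d e a b c) = sum5 V (\<lambda>a b c d e. f c d e a b)"
    by (rule sum5_rotate)
  moreover have "sum5 V (\<lambda>a b c d e. f e a b c d) = sum5 V (\<lambda>a b c d e. f d e a b c)"
    by (rule sum5_rotate)
  ultimately show ?thesis
    by (simp add: sum5_add)
qed

text \<open>The ten terms are \<open>f\<close> under permutations of its arguments, in the order of
  the two orbits in \<open>flag_product_total\<close>. Each has the same sum over all
  tuples.\<close>

lemma sum5_pair_rotations:
  "sum5 V (\<lambda>a b c d e. f a b c d e + f b c d e a + f c d e a b + f d e a b c + f e a b c d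
     + (f a b d c e + f b c e d a + f c d a e b + f d e b a c + f e a c b d)) = 10 * sum5 V f"
proof -
  have "sum5 V (\<lambda>a b c d e. f a b d c e + f b c e d a + f c d a e b + f d e b a c + f e a c b d) = 5
      * sum5 V f"
    using sum5_rotations[of V "\<lambda>a b c d e. f a b d c e"] by (simp add: sum5_swap[of V f])
  with sum5_rotations[of V f] show ?thesis
    by (simp add: sum5_add)
qed

section \<open>The certificate summed over the tuples of a relation\<close>

definition edges5 :: "('a \<Rightarrow> 'a \<Rightarrow> bool) \<Rightarrow> 'a \<Rightarrow> 'a \<Rightarrow> 'a \<Rightarrow> 'a \<Rightarrow> 'a \<Rightarrow> nat" where
  "edges5 r a b c d e =
     edge_count (r a b) (r a c) (r a d) (r a e) (r b c) (r b d) (r b e) (r c d) (r c e) (r d e)"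

definition rel_flag_product :: "('a \<Rightarrow> 'a \<Rightarrow> bool) \<Rightarrow> 'a \<Rightarrow> 'a \<Rightarrow> 'a \<Rightarrow> 'a \<Rightarrow> 'a \<Rightarrow> int" where
  "rel_flag_product r x y z u v =
     flag_product (r x y) (r x z) (r y z) (r x u) (r y u) (r z u) (r x v) (r y v) (r z v)"

definition tuple_count :: "'a set \<Rightarrow> ('a \<Rightarrow> 'a \<Rightarrow> bool) \<Rightarrow> int" where
  "tuple_count V r = sum5 V (\<lambda>a b c d e. of_bool (edges5 r a b c d e = 4))"

definition square_sum :: "'a set \<Rightarrow> ('a \<Rightarrow> 'a \<Rightarrow> bool) \<Rightarrow> int" where
  "square_sum V r = sum5 V (rel_flag_product r)"

text \<open>The condition is a parity: an even number of the three pairs is related. For a reflexive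
  symmetric relation, a triple with a repeated vertex is never bad.\<close>

definition bad_triples :: "'a set \<Rightarrow> ('a \<Rightarrow> 'a \<Rightarrow> bool) \<Rightarrow> int" where
  "bad_triples V r = (\<Sum>x\<in>V. \<Sum>y\<in>V. \<Sum>z\<in>V. of_bool (r x y \<noteq> (r x z = r y z)))"

lemma flag_product_total_rel:
  assumes s: "\<And>x y. r x y = r y x"
  shows "flag_product_total (r a b) (r a c) (r a d) (r a e) (r b c) (r b d) (r b e) (r c d) (r c e) (r d e) =
     rel_flag_product r a b c d e + rel_flag_product r b c d e a + rel_flag_product r c d e a b
         + rel_flag_product r d e a b c + rel_flag_product r e a b c d
     + (rel_flag_product r a b d c e + rel_flag_product r b c e d a + rel_flag_product r c d a e b
         + rel_flag_product r d e b a c + rel_flag_product r e a c b d)"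
proof -
  have sy: "r b a = r a b" "r c a = r a c" "r d a = r a d" "r e a = r a e" "r c b = r b c"
    "r d b = r b d" "r e b = r b e" "r d c = r c d" "r e c = r c e" "r e d = r d e"
    using s by blast+
  show ?thesis
    unfolding flag_product_total_def rel_flag_product_def sy by (rule refl)
qed

text \<open>The certificate summed over all tuples: the penalty on \<open>a, b, c\<close> leaves two
  free coordinates, and each of the ten splittings contributes one
  \<open>square_sum\<close>.\<close>

lemma tuple_count_upper:
  assumes "\<And>x y. r x y = r y x"
  shows "int (card V) ^ 2 * bad_triples V r + 192 * tuple_count V r + 10 * square_sum V r \<le> 120
      * int (card V) ^ 5"
proof -
  have "sum5 V (\<lambda>a b c d e. of_bool (r a b \<noteq> (r a c = r b c))
      + 192 * of_bool (edges5 r a b c d e = 4)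
      + (rel_flag_product r a b c d e + rel_flag_product r b c d e a + rel_flag_product r c d e a b
          + rel_flag_product r d e a b c + rel_flag_product r e a b c d
     + (rel_flag_product r a b d c e + rel_flag_product r b c e d a + rel_flag_product r c d a e b
         + rel_flag_product r d e b a c + rel_flag_product r e a c b d)))
     \<le> sum5 V (\<lambda>a b c d e. 120)"
    unfolding flag_product_total_rel[OF assms, symmetric] edges5_def
    by (intro sum5_mono certificate[rule_format])
  moreover have "sum5 V (\<lambda>a b c d e. of_bool (r a b \<noteq> (r a c = r b c))) = int (card V) ^ 2
      * bad_triples V r"
    by (simp add: sum5_def bad_triples_def sum_distrib_left power2_eq_square mult.assoc)
  ultimately show ?thesis
    using sum5_pair_rotations[of V "rel_flag_product r"]
    unfolding tuple_count_def square_sum_def sum5_add sum5_cmult sum5_const by linarith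
qed

lemma tuple_count_two_clique:
  assumes "\<And>x y. h x y = (s x = (s y :: bool))"
  shows "192 * tuple_count V h + 10 * square_sum V h = 120 * int (card V) ^ 5"
proof -
  have sym: "h x y = h y x" for x y using assms by auto
  have "sum5 V (\<lambda>a b c d e. 192 * of_bool (edges5 h a b c d e = 4)
      + (rel_flag_product h a b c d e + rel_flag_product h b c d e a + rel_flag_product h c d e a b
          + rel_flag_product h d e a b c + rel_flag_product h e a b c d
     + (rel_flag_product h a b d c e + rel_flag_product h b c e d a + rel_flag_product h c d a e b
         + rel_flag_product h d e b a c + rel_flag_product h e a c b d)))
     = sum5 V (\<lambda>a b c d e. 120)"
    unfolding flag_product_total_rel[OF sym, symmetric] edges5_def assms
    by (intro sum5_cong certificate_tight[rule_format])
  then show ?thesis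
    using sum5_pair_rotations[of V "rel_flag_product h"]
    unfolding tuple_count_def square_sum_def sum5_add sum5_cmult sum5_const by linarith
qed

definition sgn_of :: "bool \<Rightarrow> int" where "sgn_of b = (if b then 1 else - 1)"

text \<open>With \<open>m\<close> the sum of the signs, each of the ten quadratic terms of
  \<open>two_clique_value\<close> sums to \<open>m^2 n^3\<close> and each of the five quartic ones
  to \<open>m^4 n\<close>; the result is a perfect square times \<open>5 n\<close>.\<close>

lemma tuple_count_two_clique_formula:
  assumes "\<And>x y. h x y = (s x = (s y :: bool))"
  shows "8 * tuple_count V h = 5 * int (card V) * (int (card V) ^ 2 - (\<Sum>x\<in>V. sgn_of (s x)) ^ 2) ^ 2"
proof -
  define t where "t x = sgn_of (s x)" for x
  define n where "n = int (card V)"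
  define m where "m = (\<Sum>x\<in>V. t x)"
  have "8 * tuple_count V h = sum5 V (\<lambda>a b c d e. 8 * of_bool (edges5 h a b c d e = 4))"
    by (simp add: tuple_count_def sum5_cmult)
  also have "\<dots> = sum5 V (\<lambda>a b c d e. 5
      - (t a * t b + t a * t c + t a * t d + t a * t e + t b * t c + t b * t d + t b * t e
            + t c * t d + t c * t e + t d * t e)
         + (t a * t b * t c * t d + t a * t b * t c * t e + t a * t b * t d * t e
            + t a * t c * t d * t e + t b * t c * t d * t e))"
    unfolding edges5_def assms t_def sgn_of_def
    by (intro sum5_cong two_clique_value[unfolded Let_def, rule_format])
  also have "\<dots> = 5 * n ^ 5 - 10 * m ^ 2 * n ^ 3 + 5 * m ^ 4 * n"
    unfolding sum5_add sum5_diff sum5_const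
    by (simp add: sum5_def sum_distrib_left[symmetric] sum_distrib_right[symmetric] m_def[symmetric] n_def[symmetric] mult.assoc)
      (simp add: algebra_simps eval_nat_numeral)
  also have "\<dots> = 5 * n * (n ^ 2 - m ^ 2) ^ 2"
    by (simp add: algebra_simps eval_nat_numeral)
  finally show ?thesis
    unfolding n_def m_def t_def .
qed

section \<open>Comparison with two cliques\<close>

definition ext_sum :: "(bool \<Rightarrow> bool \<Rightarrow> bool \<Rightarrow> bool \<Rightarrow> bool \<Rightarrow> bool \<Rightarrow> int) \<Rightarrow> 'a set \<Rightarrow> ('a \<Rightarrow> 'a \<Rightarrow> bool)
    \<Rightarrow> 'a \<Rightarrow> 'a \<Rightarrow> 'a \<Rightarrow> int" where
  "ext_sum p V r x y z = (\<Sum>u\<in>V. p (r x y) (r x z) (r y z) (r x u) (r y u) (r z u))"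

definition type_square_sum :: "'a set \<Rightarrow> ('a \<Rightarrow> 'a \<Rightarrow> bool) \<Rightarrow> 'a \<Rightarrow> 'a \<Rightarrow> 'a \<Rightarrow> int" where
  "type_square_sum V r x y z = main_coeff (r x y) (r x z) (r y z) * (ext_sum main_flag V r x y z)\<^sup>2
     + (ext_sum (on_single_edge edge_defect_flag) V r x y z)\<^sup>2 + 10
         * (ext_sum (on_single_edge edge_skew_flag) V r x y z)\<^sup>2"

text \<open>For a fixed type the sum over \<open>u\<close> and \<open>v\<close> factorises exactly,
  because \<open>u = v\<close> and coincidences with the type are allowed.\<close>

lemma square_sum_eq: "square_sum V r = (\<Sum>x\<in>V. \<Sum>y\<in>V. \<Sum>z\<in>V. type_square_sum V r x y z)"
  unfolding square_sum_def sum5_def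
proof (intro sum.cong refl)
  fix x y z
  show "(\<Sum>d\<in>V. \<Sum>e\<in>V. rel_flag_product r x y z d e) = type_square_sum V r x y z"
    unfolding rel_flag_product_def flag_product_def type_square_sum_def ext_sum_def power2_eq_square sum_product
    by (simp only: sum.distrib sum_distrib_left)
qed

lemma main_coeff_bounds: "0 \<le> main_coeff a b c" "main_coeff a b c \<le> 12"
  by (auto simp: main_coeff_def)

lemma type_square_sum_nonneg: "0 \<le> type_square_sum V r x y z"
  unfolding type_square_sum_def by (intro add_nonneg_nonneg mult_nonneg_nonneg main_coeff_bounds) auto

lemma square_sum_nonneg: "0 \<le> square_sum V r"
  unfolding square_sum_eq by (intro sum_nonneg type_square_sum_nonneg)

lemma abs_sgn_of [simp]: "\<bar>sgn_of b\<bar> = 1"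
  by (simp add: sgn_of_def)

text \<open>The flag is odd in the side of \<open>u\<close>. The arguments
  \<open>True (a = b) (a = c)\<close> are the adjacencies of a vertex on the side of
  \<open>a\<close>, so summing over \<open>u\<close> gives the imbalance up to a factor of absolute
  value at most 2.\<close>

lemma main_flag_two_clique:
  "main_flag (a = b) (a = c) (b = c) (a = u) (b = u) (c = (u::bool))
      = main_flag (a = b) (a = c) (b = c) True (a = b) (a = c) * sgn_of a * sgn_of u"
  by (cases a; cases b; cases c; cases u) (simp_all add: main_flag_def triangle_flag_def empty_flag_def edge_flag_def sgn_of_def)

lemma on_single_edge_two_clique:
  "on_single_edge edge_defect_flag (a = b) (a = c) (b = c) (a = u) (b = u) (c = (u::bool)) = 0"
  "on_single_edge edge_skew_flag (a = b) (a = c) (b = c) (a = u) (b = u) (c = (u::bool)) = 0"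
  by (cases a; cases b; cases c; cases u;
      simp add: on_single_edge_def edge_defect_flag_def edge_skew_flag_def)+

lemma main_flag_bounds: "-2 \<le> main_flag a b c d e f" "main_flag a b c d e f \<le> 4"
  by (simp_all add: main_flag_def triangle_flag_def empty_flag_def edge_flag_def)

lemma main_flag_two_clique_bound: "\<bar>main_flag (a = b) (a = c) (b = (c::bool)) True (a = b) (a = c)\<bar>
    \<le> 2"
  by (cases a; cases b; cases c) (simp_all add: main_flag_def triangle_flag_def empty_flag_def edge_flag_def)

definition wrong4 :: "('a \<Rightarrow> 'a \<Rightarrow> bool) \<Rightarrow> 'a \<Rightarrow> 'a \<Rightarrow> 'a \<Rightarrow> 'a \<Rightarrow> bool" where
  "wrong4 D a b c d \<longleftrightarrow> D a b \<or> D a c \<or> D a d \<or> D b c \<or> D b d \<or> D c d"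

text \<open>On two cliques only the main square survives, with a base of size at most
  \<open>2 * m\<close>. Wrong pairs therefore cost a multiple of \<open>m\<close> times the number
  of affected \<open>u\<close>, instead of \<open>n\<close> times that number.\<close>

lemma type_square_sum_compare:
  fixes V :: "'a set"
  assumes h: "\<And>x y. h x y = (s x = (s y :: bool))"
    and D: "\<And>x y. D x y \<longleftrightarrow> r x y \<noteq> h x y"
  defines "m \<equiv> \<bar>\<Sum>u\<in>V. sgn_of (s u)\<bar>"
  shows "type_square_sum V h x y z \<le> type_square_sum V r x y z + 288 * m
      * (\<Sum>u\<in>V. of_bool (wrong4 D x y z u))"
proof -
  define a where "a = ext_sum main_flag V h x y z"
  define b where "b = ext_sum main_flag V r x y z"
  define w :: int where "w = (\<Sum>u\<in>V. of_bool (wrong4 D x y z u))"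
  have m0: "0 \<le> m" by (simp add: m_def)
  have w0: "0 \<le> w" by (simp add: w_def sum_nonneg)
  have "a = main_flag (s x = s y) (s x = s z) (s y = s z) True (s x = s y) (s x = s z)
      * sgn_of (s x) * (\<Sum>u\<in>V. sgn_of (s u))"
    unfolding a_def ext_sum_def h sum_distrib_left by (intro sum.cong refl main_flag_two_clique)
  then have "\<bar>a\<bar> = \<bar>main_flag (s x = s y) (s x = s z) (s y = s z) True (s x = s y) (s x = s z)\<bar> * m"
    by (simp add: abs_mult m_def sgn_of_def)
  then have am: "\<bar>a\<bar> \<le> 2 * m"
    using mult_right_mono[OF main_flag_two_clique_bound m0] by metis
  have Qh: "type_square_sum V h x y z = main_coeff (h x y) (h x z) (h y z) * a\<^sup>2"
    unfolding type_square_sum_def a_def ext_sum_def[of "on_single_edge _"] h on_single_edge_two_clique by simp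
  have Qr: "main_coeff (r x y) (r x z) (r y z) * b\<^sup>2 \<le> type_square_sum V r x y z"
    unfolding type_square_sum_def b_def
    using zero_le_power2[of "ext_sum (on_single_edge edge_defect_flag) V r x y z"] zero_le_power2[of "ext_sum (on_single_edge edge_skew_flag) V r x y z"]
    by linarith
  have "type_square_sum V h x y z \<le> type_square_sum V r x y z + 288 * m * w"
  \<comment> \<open>If the type itself contains a wrong pair, every \<open>u\<close> is affected and
    \<open>m \<le> w\<close>, so the square for \<open>h\<close> is small enough by itself.
    Otherwise the types agree and the two flag sums can be compared.\<close>
  proof (cases "D x y \<or> D x z \<or> D y z")
    case True
    then have "wrong4 D x y z u" for u
      unfolding wrong4_def by blast
    then have w: "w = int (card V)"
      by (simp add: w_def)
    have "m \<le> (\<Sum>u\<in>V. \<bar>sgn_of (s u)\<bar>)"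
      unfolding m_def by (rule sum_abs)
    then have mw: "m \<le> w"
      by (simp add: w)
    have "a\<^sup>2 \<le> (2 * m)\<^sup>2"
      using am m0 abs_le_square_iff[of a "2 * m"] by simp
    then have "main_coeff (h x y) (h x z) (h y z) * a\<^sup>2 \<le> 12 * (2 * m)\<^sup>2"
      by (intro mult_mono main_coeff_bounds) auto
    also have "\<dots> = 48 * m * m"
      by (simp add: power2_eq_square)
    also have "\<dots> \<le> 288 * m * w"
      using m0 mw by (intro mult_mono) auto
    finally show ?thesis
      using type_square_sum_nonneg[of V r x y z] Qh by linarith
  next
    case False
    then have same: "r x y = h x y" "r x z = h x z" "r y z = h y z"
      \<comment> \<open>With equal types only affected \<open>u\<close> contribute to
        \<open>b - a\<close>, each at most 6, as \<open>main_flag\<close> ranges between -2 and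
        4.\<close>
      using D by auto
    have "\<bar>b - a\<bar> \<le> (\<Sum>u\<in>V. \<bar>main_flag (r x y) (r x z) (r y z) (r x u) (r y u) (r z u)
        - main_flag (h x y) (h x z) (h y z) (h x u) (h y u) (h z u)\<bar>)"
      unfolding a_def b_def ext_sum_def sum_subtractf[symmetric] by (rule sum_abs)
    also have "\<dots> \<le> (\<Sum>u\<in>V. 6 * of_bool (wrong4 D x y z u))"
    proof (rule sum_mono)
      fix u
      show "\<bar>main_flag (r x y) (r x z) (r y z) (r x u) (r y u) (r z u)
          - main_flag (h x y) (h x z) (h y z) (h x u) (h y u) (h z u)\<bar>
        \<le> 6 * of_bool (wrong4 D x y z u)"
      proof (cases "wrong4 D x y z u")
        case True
        then show ?thesis
          using main_flag_bounds[of "r x y" "r x z" "r y z" "r x u" "r y u" "r z u"]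
            main_flag_bounds[of "h x y" "h x z" "h y z" "h x u" "h y u" "h z u"] by simp
      next
        case False
        then show ?thesis
          using same D by (auto simp: wrong4_def)
      qed
    qed
    also have "\<dots> = 6 * w"
      by (simp add: w_def sum_distrib_left)
    finally have ba: "\<bar>b - a\<bar> \<le> 6 * w" .
    \<comment> \<open>From \<open>a^2 = b^2 - 2 a (b - a) - (b - a)^2\<close>, dropping the last
      square; the coefficient bound 12 then turns \<open>24 * m * w\<close> into
      \<open>288 * m * w\<close>.\<close>
    have "- (a * (b - a)) \<le> \<bar>a\<bar> * \<bar>b - a\<bar>"
      by (metis abs_ge_minus_self abs_mult)
    also have "\<dots> \<le> 2 * m * (6 * w)"
      using am ba m0 by (intro mult_mono) auto
    finally have "a\<^sup>2 \<le> b\<^sup>2 + 24 * m * w"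
      using zero_le_power2[of "b - a"] by (simp add: power2_eq_square algebra_simps)
    then have "main_coeff (h x y) (h x z) (h y z) * a\<^sup>2 \<le> main_coeff (h x y) (h x z) (h y z)
        * (b\<^sup>2 + 24 * m * w)"
      by (intro mult_left_mono main_coeff_bounds)
    also have "\<dots> \<le> main_coeff (h x y) (h x z) (h y z) * b\<^sup>2 + 12 * (24 * m * w)"
      unfolding distrib_left using m0 w0 by (intro add_left_mono mult_right_mono main_coeff_bounds) auto
    finally show ?thesis
      using Qh Qr same by simp
  qed
  then show ?thesis by (simp only: w_def)
qed

section \<open>Counting wrong pairs and the quadruples containing them\<close>

definition wrong_count :: "'a set \<Rightarrow> ('a \<Rightarrow> 'a \<Rightarrow> bool) \<Rightarrow> int" where
  "wrong_count V D = (\<Sum>x\<in>V. \<Sum>y\<in>V. of_bool (D x y))"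

definition wrong4_count :: "'a set \<Rightarrow> ('a \<Rightarrow> 'a \<Rightarrow> bool) \<Rightarrow> int" where
  "wrong4_count V D = (\<Sum>a\<in>V. \<Sum>b\<in>V. \<Sum>c\<in>V. \<Sum>d\<in>V. of_bool (wrong4 D a b c d))"

lemma of_bool_six:
  "(of_bool (p \<or> q \<or> r \<or> s \<or> t \<or> u) :: int)
    \<le> of_bool p + of_bool q + of_bool r + of_bool s + of_bool t + of_bool u"
  by (cases p; cases q; cases r; cases s; cases t; simp)

text \<open>A union bound over the six pairs of positions, each leaving two free
  coordinates.\<close>

lemma wrong4_count_le: "wrong4_count V D \<le> 6 * int (card V) ^ 2 * wrong_count V D"
proof -
  have "wrong4_count V D \<le> (\<Sum>a\<in>V. \<Sum>b\<in>V. \<Sum>c\<in>V. \<Sum>d\<in>V. of_bool (D a b) + of_bool (D a c)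
      + of_bool (D a d) + of_bool (D b c) + of_bool (D b d) + of_bool (D c d))"
    unfolding wrong4_count_def wrong4_def by (intro sum_mono of_bool_six)
  also have "\<dots> = 6 * int (card V) ^ 2 * wrong_count V D"
    by (simp add: sum.distrib sum_distrib_left[symmetric] wrong_count_def power2_eq_square mult.assoc)
  finally show ?thesis .
qed

lemma square_sum_compare:
  fixes V :: "'a set"
  assumes h: "\<And>x y. h x y = (s x = (s y :: bool))"
    and D: "\<And>x y. D x y \<longleftrightarrow> r x y \<noteq> h x y"
  defines "m \<equiv> \<bar>\<Sum>u\<in>V. sgn_of (s u)\<bar>"
  shows "square_sum V h \<le> square_sum V r + 288 * m * wrong4_count V D"
proof -
  have "square_sum V h \<le> (\<Sum>x\<in>V. \<Sum>y\<in>V. \<Sum>z\<in>V. type_square_sum V r x y z + 288 * m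
      * (\<Sum>u\<in>V. of_bool (wrong4 D x y z u)))"
    unfolding square_sum_eq m_def by (intro sum_mono type_square_sum_compare[OF h D])
  then show ?thesis
    by (simp add: sum.distrib sum_distrib_left square_sum_eq wrong4_count_def)
qed

section \<open>Degenerate tuples\<close>

definition wrong5 :: "('a \<Rightarrow> 'a \<Rightarrow> bool) \<Rightarrow> 'a \<Rightarrow> 'a \<Rightarrow> 'a \<Rightarrow> 'a \<Rightarrow> 'a \<Rightarrow> bool" where
  "wrong5 D a b c d e \<longleftrightarrow> wrong4 D a b c d \<or> D a e \<or> D b e \<or> D c e \<or> D d e"

text \<open>A degenerate tuple repeats a vertex in one of ten pairs of positions. After moving that
  pair to the end, deleting the repetition leaves a quadruple that still contains a wrong
  pair.\<close>

lemma sum5_nondistinct_wrong: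
  assumes V: "finite V" and irr: "\<And>x. \<not> D x x" and sym: "\<And>x y. D x y = D y x"
  shows "sum5 V (\<lambda>a b c d e. of_bool (\<not> distinct [a, b, c, d, e] \<and> wrong5 D a b c d e)) \<le> 10
      * wrong4_count V D"
proof -
  define f :: "'a \<Rightarrow> 'a \<Rightarrow> 'a \<Rightarrow> 'a \<Rightarrow> 'a \<Rightarrow> int"
    where "f a b c d e = of_bool (d = e \<and> wrong4 D a b c d)" for a b c d e
  have nonneg: "0 \<le> f a b c d e" for a b c d e
    by (simp add: f_def)
  have rot: "wrong5 D b c d e a = wrong5 D a b c d e" for a b c d e
    unfolding wrong5_def wrong4_def sym[of b a] sym[of c a] sym[of d a] sym[of e a] by blast
  have swap: "wrong5 D a b d c e = wrong5 D a b c d e" for a b c d e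
    unfolding wrong5_def wrong4_def sym[of d c] by blast
  \<comment> \<open>Irreflexivity of \<open>D\<close> is what prevents the deleted pair from being
    the only wrong one.\<close>
  have merge: "wrong4 D a b c d" if "wrong5 D a b c d d" for a b c d
    using that irr unfolding wrong5_def wrong4_def by blast
  have hit: "f a b c d e = 1" if "wrong5 D a b c d e" "d = e" for a b c d e
    using that merge by (simp add: f_def)
  have pt: "of_bool (\<not> distinct [a, b, c, d, e] \<and> wrong5 D a b c d e) \<le>
     f a b c d e + f b c d e a + f c d e a b + f d e a b c + f e a b c d
     + (f a b d c e + f b c e d a + f c d a e b + f d e b a c + f e a c b d)" for a b c d e
  proof (cases "\<not> distinct [a, b, c, d, e] \<and> wrong5 D a b c d e")
    case True
    then have w: "wrong5 D a b c d e" "wrong5 D b c d e a" "wrong5 D c d e a b" "wrong5 D d e a b c"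
      "wrong5 D e a b c d" "wrong5 D a b d c e" "wrong5 D b c e d a" "wrong5 D c d a e b"
      "wrong5 D d e b a c" "wrong5 D e a c b d"
      using rot swap by metis+
    consider "d = e" | "e = a" | "a = b" | "b = c" | "c = d" | "c = e" | "d = a" | "e = b" | "a
        = c" | "b = d"
      using True by auto
    then have "\<exists>t \<in> {f a b c d e, f b c d e a, f c d e a b, f d e a b c, f e a b c d,
      f a b d c e, f b c e d a, f c d a e b, f d e b a c, f e a c b d}. t = 1"
      by cases (use w[THEN hit] in blast)+
    with nonneg[of a b c d e] nonneg[of b c d e a] nonneg[of c d e a b] nonneg[of d e a b c]
      nonneg[of e a b c d] nonneg[of a b d c e] nonneg[of b c e d a] nonneg[of c d a e b] nonneg[of d e b a c]
      nonneg[of e a c b d]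
    have "1 \<le> f a b c d e + f b c d e a + f c d e a b + f d e a b c + f e a b c d
     + (f a b d c e + f b c e d a + f c d a e b + f d e b a c + f e a c b d)"
      by (elim bexE insertE emptyE) linarith+
    then show ?thesis
      by (simp only: True of_bool_eq not_False_eq_True simp_thms)
  next
    case False
    then show ?thesis
      by (simp only: False of_bool_eq) (intro add_nonneg_nonneg nonneg)
  qed
  have "sum5 V (\<lambda>a b c d e. of_bool (\<not> distinct [a, b, c, d, e] \<and> wrong5 D a b c d e)) \<le> 10
      * sum5 V f"
    unfolding sum5_pair_rotations[symmetric] by (intro sum5_mono pt)
  also have "sum5 V f = wrong4_count V D"
    unfolding sum5_def wrong4_count_def
  proof (intro sum.cong refl)
    fix a b c d
    assume "d \<in> V"
    have "(\<Sum>e\<in>V. f a b c d e) = (\<Sum>e\<in>V. if d = e then of_bool (wrong4 D a b c d) else 0)"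
      by (intro sum.cong) (auto simp: f_def)
    then show "(\<Sum>e\<in>V. f a b c d e) = of_bool (wrong4 D a b c d)"
      using V \<open>d \<in> V\<close> by simp
  qed
  finally show ?thesis .
qed

definition distinct_tuple_count :: "'a set \<Rightarrow> ('a \<Rightarrow> 'a \<Rightarrow> bool) \<Rightarrow> int" where
  "distinct_tuple_count V r = sum5 V (\<lambda>a b c d e. of_bool (distinct [a, b, c, d, e]
      \<and> edges5 r a b c d e = 4))"

lemma of_bool_split: "(of_bool X :: int) = of_bool (P \<and> X) + of_bool (\<not> P \<and> X)"
  by (cases P) simp_all

lemma tuple_count_split:
  "tuple_count V r = distinct_tuple_count V r
      + sum5 V (\<lambda>a b c d e. of_bool (\<not> distinct [a, b, c, d, e] \<and> edges5 r a b c d e = 4))"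
  unfolding tuple_count_def distinct_tuple_count_def sum5_add[symmetric]
      by (intro sum5_cong of_bool_split)

lemma distinct_tuple_count_le: "distinct_tuple_count V r \<le> tuple_count V r"
  unfolding tuple_count_def distinct_tuple_count_def
      by (intro sum5_mono of_bool_less_eq_iff[THEN iffD2] impI) (rule conjunct2)

lemma edges5_cong:
  assumes "\<And>x y. D x y \<longleftrightarrow> r x y \<noteq> h x y" "\<not> wrong5 D a b c d e"
  shows "edges5 r a b c d e = edges5 h a b c d e"
  using assms by (simp add: wrong5_def wrong4_def edges5_def)

text \<open>Subtracting the tight identity for \<open>h\<close> from the bound for \<open>r\<close>
  leaves the difference of the squares. The constants are \<open>17280 = 10 * 288 * 6\<close> from
  the squares and \<open>11520 = 192 * 10 * 6\<close> from degenerate tuples.\<close>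

lemma tuple_count_compare:
  fixes V :: "'a set"
  assumes V: "finite V" and r: "\<And>x. r x x" "\<And>x y. r x y = r y x"
    and h: "\<And>x y. h x y = (s x = (s y :: bool))"
    and D: "\<And>x y. D x y \<longleftrightarrow> r x y \<noteq> h x y"
  defines "n \<equiv> int (card V)" and "m \<equiv> \<bar>\<Sum>u\<in>V. sgn_of (s u)\<bar>"
  shows "192 * distinct_tuple_count V r + n\<^sup>2 * bad_triples V r \<le> 192 * distinct_tuple_count V h
      + (11520 + 17280 * m) * n\<^sup>2 * wrong_count V D"
    and "192 * tuple_count V r + n\<^sup>2 * bad_triples V r \<le> 192 * tuple_count V h + 17280 * m * n\<^sup>2
        * wrong_count V D"
proof -
  have m: "0 \<le> m" by (simp add: m_def)
  have hs: "h x y = h y x" for x y using h by auto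
  have "sum5 V (\<lambda>a b c d e. of_bool (\<not> distinct [a, b, c, d, e] \<and> edges5 h a b c d e = 4))
    \<le> sum5 V (\<lambda>a b c d e. of_bool (\<not> distinct [a, b, c, d, e] \<and> edges5 r a b c d e = 4)
         + of_bool (\<not> distinct [a, b, c, d, e] \<and> wrong5 D a b c d e))"
  proof (rule sum5_mono)
    fix a b c d e
    show "of_bool (\<not> distinct [a, b, c, d, e] \<and> edges5 h a b c d e = 4) \<le>
      (of_bool (\<not> distinct [a, b, c, d, e] \<and> edges5 r a b c d e = 4)
         + of_bool (\<not> distinct [a, b, c, d, e] \<and> wrong5 D a b c d e) :: int)"
    proof (cases "wrong5 D a b c d e")
      case True
      have "(of_bool (P \<and> X) :: int) \<le> of_bool (P \<and> Y) + of_bool P" for P X Y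
        by (cases P; cases X) simp_all
      then show ?thesis by (simp only: True simp_thms)
    next
      case False
      show ?thesis by (simp only: edges5_cong[of D r h a b c d e, OF D False]) simp
    qed

  qed
  moreover have "sum5 V (\<lambda>a b c d e. of_bool (\<not> distinct [a, b, c, d, e] \<and> wrong5 D a b c d e)) \<le> 10
      * wrong4_count V D"
    using D r h hs by (intro sum5_nondistinct_wrong V) auto
  ultimately have R: "tuple_count V h - distinct_tuple_count V h \<le> tuple_count V r
      - distinct_tuple_count V r + 10 * wrong4_count V D"
    unfolding tuple_count_split[of V h] tuple_count_split[of V r] sum5_add by linarith
  have W: "wrong4_count V D \<le> 6 * n\<^sup>2 * wrong_count V D"
    unfolding n_def by (rule wrong4_count_le)
  have P: "192 * tuple_count V r + n\<^sup>2 * bad_triples V r \<le> 192 * tuple_count V h + 2880 * m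
      * wrong4_count V D"
    using tuple_count_upper[of r V, OF r(2)] tuple_count_two_clique[of h s V, OF h] square_sum_compare[of h s D r V, OF h D]
    unfolding n_def m_def by linarith
  have mW: "2880 * m * wrong4_count V D \<le> 2880 * m * (6 * n\<^sup>2 * wrong_count V D)"
    using W m by (intro mult_left_mono) auto
  show "192 * tuple_count V r + n\<^sup>2 * bad_triples V r \<le> 192 * tuple_count V h + 17280 * m * n\<^sup>2
      * wrong_count V D"
    using P mW by (simp add: mult_ac)
  have "192 * distinct_tuple_count V r + n\<^sup>2 * bad_triples V r \<le> 192 * distinct_tuple_count V h
      + 2880 * m * (6 * n\<^sup>2 * wrong_count V D) + 1920 * (6 * n\<^sup>2 * wrong_count V D)"
    using P mW R W by linarith
  then show "192 * distinct_tuple_count V r + n\<^sup>2 * bad_triples V r \<le> 192 * distinct_tuple_count V h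
      + (11520 + 17280 * m) * n\<^sup>2 * wrong_count V D"
    by (simp add: algebra_simps)
qed

text \<open>By parity, \<open>v, x, y\<close> is bad exactly when \<open>x, y\<close> is wrong for
  the two cliques given by the neighbourhood of \<open>v\<close> and its complement. A vertex
  minimising the number of wrong pairs is at most average.\<close>

lemma exists_good_vertex:
  assumes "finite V" "V \<noteq> {}"
  obtains v where "v \<in> V" "int (card V) * wrong_count V (\<lambda>x y. r x y \<noteq> (r v x = r v y))
      \<le> bad_triples V r"
proof -
  have eq: "bad_triples V r = (\<Sum>v\<in>V. wrong_count V (\<lambda>x y. r x y \<noteq> (r v x = r v y)))"
    unfolding bad_triples_def wrong_count_def by (intro sum.cong refl arg_cong[of _ _ of_bool]) auto
  define w where "w v = wrong_count V (\<lambda>x y. r x y \<noteq> (r v x = r v y))" for v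
  obtain v where v: "v \<in> V" "\<And>u. u \<in> V \<Longrightarrow> w v \<le> w u"
    using assms by (metis arg_min_if_finite(1) arg_min_least)
  have "int (card V) * w v \<le> (\<Sum>u\<in>V. w u)"
    using sum_bounded_below[of V "w v" w] v(2) by simp
  then show ?thesis
    using that v(1) eq unfolding w_def by simp
qed

section \<open>Counting five-sets with four edges\<close>

definition adj_eq :: "'a graph \<Rightarrow> 'a \<Rightarrow> 'a \<Rightarrow> bool" where
  "adj_eq G x y \<longleftrightarrow> x = y \<or> {x, y} \<in> edges G"

lemma sum_lists_Suc:
  assumes "finite V"
  shows "(\<Sum>xs | set xs \<subseteq> V \<and> length xs = Suc k. g xs)
      = (\<Sum>x\<in>V. \<Sum>xs | set xs \<subseteq> V \<and> length xs = k. (g (x # xs) :: int))"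
proof -
  have eq: "{xs. set xs \<subseteq> V \<and> length xs = Suc k}
      = (\<lambda>(x, xs). x # xs) ` (V \<times> {xs. set xs \<subseteq> V \<and> length xs = k})"
    by (auto simp: length_Suc_conv image_iff)
  show ?thesis
    unfolding eq sum.cartesian_product by (subst sum.reindex) (auto simp: inj_on_def case_prod_unfold)
qed

lemma sum5_lists:
  assumes "finite V"
  shows "sum5 V (\<lambda>a b c d e. of_bool (P [a, b, c, d, e]))
      = int (card {xs. set xs \<subseteq> V \<and> length xs = 5 \<and> P xs})"
proof -
  have five: "5 = Suc (Suc (Suc (Suc (Suc 0))))" by simp
  have z: "{xs. set xs \<subseteq> V \<and> length xs = 0} = {[]}" by auto
  have fin: "finite {xs. set xs \<subseteq> V \<and> length xs = 5}"
    by (rule finite_lists_length_eq[OF assms])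
  have "sum5 V (\<lambda>a b c d e. of_bool (P [a, b, c, d, e]))
      = (\<Sum>xs | set xs \<subseteq> V \<and> length xs = 5. of_bool (P xs))"
    unfolding sum5_def five sum_lists_Suc[OF assms] z by (simp del: sum_of_bool_eq)
  also have "\<dots> = int (card {xs \<in> {xs. set xs \<subseteq> V \<and> length xs = 5}. P xs})"
    using fin by (simp add: Int_def)
  finally show ?thesis
    by (simp add: conj_ac)
qed

text \<open>Every set of size \<open>k\<close> has \<open>fact k\<close> orderings; for
  \<open>k = 5\<close> this is the factor 120 between sets and tuples.\<close>

lemma card_distinct_lists:
  assumes "finite V"
  shows "card {xs. set xs \<subseteq> V \<and> length xs = k \<and> distinct xs \<and> F (set xs)} = fact k
      * card {S. S \<subseteq> V \<and> card S = k \<and> F S}"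
proof -
  define \<S> where "\<S> = {S. S \<subseteq> V \<and> card S = k \<and> F S}"
  have fin: "finite S" if "S \<in> \<S>" for S
    using that assms finite_subset by (auto simp: \<S>_def)
  have eq: "{xs. set xs \<subseteq> V \<and> length xs = k \<and> distinct xs \<and> F (set xs)}
      = (\<Union>S\<in>\<S>. permutations_of_set S)"
    by (auto simp: \<S>_def permutations_of_set_def distinct_card)
  have "card (\<Union>S\<in>\<S>. permutations_of_set S) = (\<Sum>S\<in>\<S>. card (permutations_of_set S))"
  proof (rule card_UN_disjoint)
    show "finite \<S>"
      using assms by (rule_tac finite_subset[of _ "Pow V"]) (auto simp: \<S>_def)
    show "\<forall>S\<in>\<S>. \<forall>S'\<in>\<S>. S \<noteq> S' \<longrightarrow> permutations_of_set S \<inter> permutations_of_set S' = {}"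
      by (auto simp: permutations_of_set_def)
  qed (use fin in simp)
  also have "\<dots> = (\<Sum>S\<in>\<S>. fact k)"
    using fin by (intro sum.cong refl) (simp add: \<S>_def)
  finally show ?thesis
    unfolding eq by (simp add: \<S>_def)
qed

lemma edges5_eq_card:
  assumes "distinct [a, b, c, d, e]" "\<And>f. f \<in> E \<Longrightarrow> card f = 2"
  shows "edges5 (\<lambda>x y. x = y \<or> {x, y} \<in> E) a b c d e = card {f \<in> E. f \<subseteq> {a, b, c, d, e}}"
proof -
  define T where "T = {{a,b},{a,c},{a,d},{a,e},{b,c},{b,d},{b,e},{c,d},{c,e},{d,e}}"
  have finT: "finite T" by (simp add: T_def)
  have "{f \<in> E. f \<subseteq> {a, b, c, d, e}} = T \<inter> {f. f \<in> E}"
  proof (intro equalityI subsetI)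
    fix f assume f: "f \<in> {f \<in> E. f \<subseteq> {a, b, c, d, e}}"
    then have "card f = 2"
      using assms(2) by simp
    then obtain x y where "f = {x, y}" "x \<noteq> y"
      by (meson card_2_iff)
    moreover from this f have "x \<in> {a, b, c, d, e}" "y \<in> {a, b, c, d, e}" "f \<in> E"
      by auto
    ultimately show "f \<in> T \<inter> {f. f \<in> E}"
      unfolding T_def by (elim insertE emptyE) (simp_all add: doubleton_eq_iff)
  qed (auto simp: T_def)
  then have "card {f \<in> E. f \<subseteq> {a, b, c, d, e}} = (\<Sum>f\<in>T. of_bool (f \<in> E))"
    using finT by simp
  also have "\<dots> = edges5 (\<lambda>x y. x = y \<or> {x, y} \<in> E) a b c d e"
    using assms(1) unfolding T_def edges5_def edge_count_def
        by (simp add: doubleton_eq_iff del: sum_of_bool_eq)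
  finally show ?thesis by simp
qed

definition four_edge_sets :: "'a graph \<Rightarrow> nat" where
  "four_edge_sets G = card {S. S \<subseteq> verts G \<and> card S = 5 \<and> card {e \<in> edges G. e \<subseteq> S} = 4}"

lemma distinct_tuple_count_eq:
  assumes "simple_graph G"
  shows "distinct_tuple_count (verts G) (adj_eq G) = 120 * int (four_edge_sets G)"
proof -
  have fin: "finite (verts G)" and E: "\<And>f. f \<in> edges G \<Longrightarrow> card f = 2"
    using assms by (auto simp: simple_graph_def)
  have r: "adj_eq G = (\<lambda>x y. x = y \<or> {x, y} \<in> edges G)"
    by (intro ext) (simp add: adj_eq_def)
  have "distinct_tuple_count (verts G) (adj_eq G)
      = sum5 (verts G) (\<lambda>a b c d e. of_bool (distinct [a, b, c, d, e] \<and>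
      card {f \<in> edges G. f \<subseteq> set [a, b, c, d, e]} = 4))"
    unfolding distinct_tuple_count_def r
    by (intro sum5_cong arg_cong[of _ _ of_bool] conj_cong refl) (simp only: edges5_eq_card[OF _ E] list.set)
  also have "\<dots> = int (card {xs. set xs \<subseteq> verts G \<and> length xs = 5 \<and> distinct xs
      \<and> card {f \<in> edges G. f \<subseteq> set xs} = 4})"
    by (rule sum5_lists[OF fin, of "\<lambda>xs. distinct xs \<and> card {f \<in> edges G. f \<subseteq> set xs} = 4"])
  also have "\<dots> = 120 * int (four_edge_sets G)"
    unfolding card_distinct_lists[OF fin, of 5 "\<lambda>S. card {f \<in> edges G. f \<subseteq> S}
        = 4"] four_edge_sets_def
    by (simp add: fact_numeral)
  finally show ?thesis .
qed

lemma binomial5: "120 * real (n choose 5) = real n * (real n - 1) * (real n - 2) * (real n - 3)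
    * (real n - 4)"
  by (simp add: binomial_gbinomial gbinomial_prod_rev fact_numeral eval_nat_numeral prod.atLeast0_lessThan_Suc)

lemma binomial5_le: "120 * real (n choose 5) \<le> real n ^ 5"
proof (cases "n < 5")
  case False
  then have "real n * (real n - 1) * (real n - 2) * (real n - 3) * (real n - 4) \<le> real n * real n
      * real n * real n * real n"
    by (intro mult_mono) auto
  then show ?thesis
    unfolding binomial5 by (simp add: eval_nat_numeral mult.assoc)
qed (simp add: binomial_eq_0)

lemma binomial5_ge: "real n ^ 5 - 10 * real n ^ 4 \<le> 120 * real (n choose 5)"
proof -
  \<comment> \<open>The remainder \<open>35 n^3 - 50 n^2 + 24 n\<close>, with the square completed
    in the quadratic factor.\<close>
  have "0 \<le> real n * (35 * (real n - 5 / 7)\<^sup>2 + 43 / 7)"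
    by simp
  also have "\<dots> = 120 * real (n choose 5) - (real n ^ 5 - 10 * real n ^ 4)"
    unfolding binomial5 by (simp add: algebra_simps power2_eq_square eval_nat_numeral)
  finally show ?thesis by simp
qed

lemma nondistinct_tuple_count_le:
  assumes "finite V"
  shows "real_of_int (tuple_count V r) - real_of_int (distinct_tuple_count V r) \<le> 10
      * real (card V) ^ 4"
proof -
  have d: "sum5 V (\<lambda>a b c d e. of_bool (distinct [a, b, c, d, e])) = 120 * int (card V choose 5)"
    using sum5_lists[OF assms, of distinct] card_distinct_lists[OF assms, of 5 "\<lambda>_. True"] n_subsets[OF assms, of 5]
    by (simp add: fact_numeral)
  have le: "(of_bool (\<not> P \<and> X) :: int) \<le> 1 - of_bool P" for P X
    by (cases P; cases X) simp_all
  have "tuple_count V r - distinct_tuple_count V r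
      \<le> sum5 V (\<lambda>a b c d e. 1 - of_bool (distinct [a, b, c, d, e]))"
    unfolding tuple_count_split[of V r] add_diff_cancel_left' by (intro sum5_mono le)
  also have "\<dots> = int (card V) ^ 5 - 120 * int (card V choose 5)"
    unfolding sum5_diff sum5_const d by simp
  finally have "real_of_int (tuple_count V r - distinct_tuple_count V r)
      \<le> real_of_int (int (card V) ^ 5 - 120 * int (card V choose 5))"
    by (simp only: of_int_le_iff)
  then show ?thesis
    using binomial5_ge[of "card V"] by simp
qed

lemma distinct_tuple_count_cong:
  assumes "\<And>x y. \<lbrakk>x \<in> V; y \<in> V\<rbrakk> \<Longrightarrow> r x y = h x y"
  shows "distinct_tuple_count V r = distinct_tuple_count V h"
  unfolding distinct_tuple_count_def edges5_def by (intro sum5_cong) (simp only: assms)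

lemma density_four_edge_sets: "density 5 4 G
    = real (four_edge_sets G) / real (card (verts G) choose 5)"
  by (simp add: density_def four_edge_sets_def)

text \<open>These two facts make \<open>Max\<close> in \<open>max_density\<close> meaningful: the
  numerators are bounded by the number of vertex subsets, and the empty graph is a witness.\<close>

lemma max_density_props:
  fixes k l n
  defines "S \<equiv> {density k l G | G :: nat graph. simple_graph G \<and> card (verts G) = n}"
  shows finite_densities: "finite S" and densities_nonempty: "S \<noteq> {}"
proof -
  have "S \<subseteq> (\<lambda>j. real j / real (n choose k)) ` {..2 ^ n}"
  proof
    fix d assume "d \<in> S"
    then obtain G :: "nat graph" where G: "simple_graph G" "card (verts G) = n" "d = density k l G"
      by (auto simp: S_def)
    then have fin: "finite (verts G)" by (simp add: simple_graph_def)
    have "card {S. S \<subseteq> verts G \<and> card S = k \<and> card {e \<in> edges G. e \<subseteq> S} = l} \<le> card (Pow (verts G))"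
      using fin by (intro card_mono) auto
    then show "d \<in> (\<lambda>j. real j / real (n choose k)) ` {..2 ^ n}"
      using G fin by (auto simp: density_def card_Pow)
  qed
  then show "finite S" by (rule finite_subset) simp
  have "simple_graph (graph_on n {})" "card (verts (graph_on n {})) = n"
    by (simp_all add: simple_graph_def graph_on_def)
  then have "density k l (graph_on n {}) \<in> S"
    unfolding S_def by blast
  then show "S \<noteq> {}" by blast
qed

lemma density_le_max_density:
  fixes G :: "nat graph"
  assumes "simple_graph G"
  shows "density k l G \<le> max_density k l (card (verts G))"
  unfolding max_density_def using assms by (intro Max_ge finite_densities) blast

lemma max_density_attained:
  obtains G :: "nat graph" where "simple_graph G" "card (verts G) = n" "max_density k l n
      = density k l G"
  using Max_in[OF finite_densities densities_nonempty, of k l n] unfolding max_density_def by blast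

section \<open>Blowups of the pattern\<close>

abbreviation two_loops :: "nat graph" where
  "two_loops \<equiv> graph_on 2 {{0, 0}, {1, 1}}"

context
  fixes V :: "nat \<Rightarrow> 'a set"
  assumes V: "valid_parts two_loops V"
begin

lemma two_clique_parts: "finite (V 0)" "finite (V 1)" "V 0 \<inter> V 1 = {}"
  using V by (auto simp: valid_parts_def graph_on_def disjoint_family_on_def)

lemma verts_two_clique: "verts (blowup two_loops V) = V 0 \<union> V 1"
  by (auto simp: blowup_def graph_on_def numeral_2_eq_2 lessThan_Suc)

lemma card_verts_two_clique: "card (verts (blowup two_loops V)) = card (V 0) + card (V 1)"
  unfolding verts_two_clique using two_clique_parts by (intro card_Un_disjoint)

lemma edges_two_clique:
  "edges (blowup two_loops V) = {{x, y} |x y. x \<noteq> y \<and> (x \<in> V 0 \<and> y \<in> V 0 \<or> x \<in> V 1 \<and> y \<in> V 1)}"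
proof -
  have "(\<exists>i\<in>{..<2}. \<exists>j\<in>{..<2}. x \<in> V i \<and> y \<in> V j \<and> {i, j} \<in> {{0, 0}, {1, 1}})
      \<longleftrightarrow> x \<in> V 0 \<and> y \<in> V 0 \<or> x \<in> V 1 \<and> y \<in> V 1" for x y
    by (auto simp: numeral_2_eq_2 lessThan_Suc doubleton_eq_iff)
  then show ?thesis
    by (simp add: blowup_def graph_on_def)
qed

lemma simple_graph_two_clique: "simple_graph (blowup two_loops V)"
  unfolding simple_graph_def verts_two_clique edges_two_clique
  using two_clique_parts by auto

lemma adj_eq_two_clique:
  assumes "x \<in> V 0 \<union> V 1" "y \<in> V 0 \<union> V 1"
  shows "adj_eq (blowup two_loops V) x y \<longleftrightarrow> (x \<in> V 0) = (y \<in> V 0)"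
  using assms two_clique_parts(3)
  unfolding adj_eq_def edges_two_clique by (auto simp: doubleton_eq_iff)

lemma four_edge_sets_two_clique:
  "120 * int (four_edge_sets (blowup two_loops V))
      = distinct_tuple_count (V 0 \<union> V 1) (\<lambda>x y. (x \<in> V 0) = (y \<in> V 0))"
  unfolding distinct_tuple_count_eq[OF simple_graph_two_clique, symmetric] verts_two_clique
  by (rule distinct_tuple_count_cong[OF adj_eq_two_clique])

text \<open>The closed formula counts tuples with repetition. Restricting to distinct entries can
  only lower the count, and by at most \<open>10 * n ^ 4\<close>.\<close>

lemma four_edge_sets_two_clique_bounds:
  defines "n \<equiv> real (card (V 0)) + real (card (V 1))" and "m \<equiv> real (card (V 0))
      - real (card (V 1))"
  shows "120 * real (four_edge_sets (blowup two_loops V)) \<le> 5 / 8 * n * (n\<^sup>2 - m\<^sup>2)\<^sup>2"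
    and "5 / 8 * n * (n\<^sup>2 - m\<^sup>2)\<^sup>2 - 10 * n ^ 4 \<le> 120 * real (four_edge_sets (blowup two_loops V))"
proof -
  define U where "U = V 0 \<union> V 1"
  define h where "h x y \<longleftrightarrow> (x \<in> V 0) = (y \<in> V 0)" for x y
  have fin: "finite U" using two_clique_parts by (simp add: U_def)
  have n: "real (card U) = n"
    unfolding U_def n_def using two_clique_parts by (simp add: card_Un_disjoint)
  have "(\<Sum>x\<in>U. sgn_of (x \<in> V 0)) = (\<Sum>x\<in>V 0. sgn_of (x \<in> V 0)) + (\<Sum>x\<in>V 1. sgn_of (x \<in> V 0))"
    unfolding U_def using two_clique_parts by (intro sum.union_disjoint)
  also have "(\<Sum>x\<in>V 0. sgn_of (x \<in> V 0)) = (\<Sum>x\<in>V 0. 1)"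
    by (intro sum.cong) (auto simp: sgn_of_def)
  also have "(\<Sum>x\<in>V 1. sgn_of (x \<in> V 0)) = (\<Sum>x\<in>V 1. - 1)"
    using two_clique_parts(3) by (intro sum.cong) (auto simp: sgn_of_def)
  finally have m: "real_of_int (\<Sum>x\<in>U. sgn_of (x \<in> V 0)) = m"
    by (simp add: m_def)
  have "real_of_int (8 * tuple_count U h)
      = real_of_int (5 * int (card U) * ((int (card U))\<^sup>2 - (\<Sum>x\<in>U. sgn_of (x \<in> V 0))\<^sup>2)\<^sup>2)"
    using tuple_count_two_clique_formula[of h "\<lambda>x. x \<in> V 0" U] h_def by simp
  then have tuple_count: "real_of_int (tuple_count U h) = 5 / 8 * n * (n\<^sup>2 - m\<^sup>2)\<^sup>2"
    unfolding of_int_mult of_int_diff of_int_power m of_int_of_nat_eq n by simp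
  have "120 * int (four_edge_sets (blowup two_loops V)) = distinct_tuple_count U h"
    unfolding four_edge_sets_two_clique U_def h_def ..
  then have distinct_tuple_count: "120 * real (four_edge_sets (blowup two_loops V))
      = real_of_int (distinct_tuple_count U h)"
    by linarith
  show "120 * real (four_edge_sets (blowup two_loops V)) \<le> 5 / 8 * n * (n\<^sup>2 - m\<^sup>2)\<^sup>2"
    using distinct_tuple_count_le[of U h] tuple_count distinct_tuple_count by linarith
  show "5 / 8 * n * (n\<^sup>2 - m\<^sup>2)\<^sup>2 - 10 * n ^ 4 \<le> 120 * real (four_edge_sets (blowup two_loops V))"
    using nondistinct_tuple_count_le[OF fin, of h] tuple_count distinct_tuple_count n by simp
qed

end

section \<open>The limit of the maximum density\<close>

lemma max_density_ge:
  "5 / 8 * real n * ((real n)\<^sup>2 - 1)\<^sup>2 - 10 * real n ^ 4 \<le> 120 * real (n choose 5)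
      * max_density 5 4 n"
proof (cases "n < 5")
  case True
  \<comment> \<open>Here the binomial coefficient is 0, and the left side is nonpositive in each of
    the five cases.\<close>
  then have "real n = 0 \<or> real n = 1 \<or> real n = 2 \<or> real n = 3 \<or> real n = 4" by auto
  with True show ?thesis by (auto simp: binomial_eq_0)
next
  case False
  \<comment> \<open>Two cliques of sizes \<open>n div 2\<close> and \<open>n - n div 2\<close>: the
    imbalance is at most 1 for either parity.\<close>
  define V where "V i = (if i = 0 then {..n div 2} - {n div 2} else {n div 2..<n})" for i :: nat
  have V: "valid_parts two_loops V"
    by (auto simp: V_def valid_parts_def disjoint_family_on_def graph_on_def)
  have c: "real (card (V 0)) + real (card (V 1)) = real n"
    "(real (card (V 0)) - real (card (V 1)))\<^sup>2 \<le> 1"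
  proof -
    have "card (V 0) = n div 2" "card (V 1) = n - n div 2"
      by (simp_all add: V_def)
    moreover have "real n - 2 * real (n div 2) = 0 \<or> real n - 2 * real (n div 2) = 1"
    proof -
      define k where "k = n div 2"
      have "n = 2 * k \<or> n = 2 * k + 1" unfolding k_def by auto
      then show ?thesis unfolding k_def[symmetric] by auto
    qed
    moreover have "real (n - n div 2) = real n - real (n div 2)"
      by (simp add: of_nat_diff)
    moreover have "real (n div 2) - (real n - real (n div 2)) = - (real n - 2 * real (n div 2))"
      by simp
    ultimately show "real (card (V 0)) + real (card (V 1)) = real n"
      "(real (card (V 0)) - real (card (V 1)))\<^sup>2 \<le> 1"
      by (simp, metis power2_minus power2_eq_square mult_zero_left mult_1 order_refl zero_le_one)
  qed
  define H where "H = blowup two_loops V"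
  have cH: "card (verts H) = n"
    using c(1) unfolding H_def card_verts_two_clique[OF V] by linarith
  have "((real n)\<^sup>2 - 1)\<^sup>2 \<le> ((real n)\<^sup>2 - (real (card (V 0)) - real (card (V 1)))\<^sup>2)\<^sup>2"
    using c(2) False by (intro power_mono) auto
  then have "5 / 8 * real n * ((real n)\<^sup>2 - 1)\<^sup>2 \<le> 5 / 8 * real n
      * ((real n)\<^sup>2 - (real (card (V 0)) - real (card (V 1)))\<^sup>2)\<^sup>2"
    by (intro mult_left_mono) auto
  then have "5 / 8 * real n * ((real n)\<^sup>2 - 1)\<^sup>2 - 10 * real n ^ 4 \<le> 120 * real (four_edge_sets H)"
    using four_edge_sets_two_clique_bounds(2)[OF V] unfolding c(1) H_def by linarith
  also have "\<dots> = 120 * real (n choose 5) * density 5 4 H"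
    using False by (simp add: density_four_edge_sets cH)
  also have "\<dots> \<le> 120 * real (n choose 5) * max_density 5 4 n"
    using density_le_max_density[of H 5 4, unfolded cH] simple_graph_two_clique[OF V]
    by (intro mult_left_mono) (simp_all only: H_def of_nat_0_le_iff zero_le_mult_iff, simp)
  finally show ?thesis .
qed

lemma adj_eq_refl_sym: "adj_eq G x x" "adj_eq G x y = adj_eq G y x"
  by (auto simp: adj_eq_def insert_commute)

lemma bad_triples_nonneg: "0 \<le> bad_triples V r"
  by (simp add: bad_triples_def sum_nonneg)

lemma four_edge_sets_le:
  assumes "simple_graph G"
  shows "120 * real (four_edge_sets G) \<le> 5 / 8 * real (card (verts G)) ^ 5"
proof -
  let ?V = "verts G" and ?r = "adj_eq G"
  have "192 * tuple_count ?V ?r \<le> 120 * int (card ?V) ^ 5"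
    using tuple_count_upper[of ?r ?V, OF adj_eq_refl_sym(2)] square_sum_nonneg[of ?V ?r]
      mult_nonneg_nonneg[OF zero_le_power2 bad_triples_nonneg, of "int (card ?V)" ?V ?r] by linarith
  then have "192 * (120 * int (four_edge_sets G)) \<le> 120 * int (card ?V) ^ 5"
    using distinct_tuple_count_le[of ?V ?r] distinct_tuple_count_eq[OF assms] by linarith
  then have "real_of_int (192 * (120 * int (four_edge_sets G)))
      \<le> real_of_int (120 * int (card ?V) ^ 5)"
    by (simp only: of_int_le_iff)
  then show ?thesis by simp
qed

lemma max_density_le: "120 * real (n choose 5) * max_density 5 4 n \<le> 5 / 8 * real n ^ 5"
proof -
  obtain G :: "nat graph" where G: "simple_graph G" "card (verts G) = n" "max_density 5 4 n
      = density 5 4 G"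
    by (rule max_density_attained)
  show ?thesis
    using four_edge_sets_le[OF G(1)] by (cases "n choose 5
        = 0") (auto simp: G density_four_edge_sets)
qed

lemma max_density_tendsto: "max_density 5 4 \<longlonglongrightarrow> 5 / 8"
proof (rule tendsto_sandwich)
  let ?b = "\<lambda>n. real n * (real n - 1) * (real n - 2) * (real n - 3) * (real n - 4)"
  have pos: "0 < ?b n" if "n \<ge> 5" for n
    using that by (intro mult_pos_pos) auto
  show "\<forall>\<^sub>F n in sequentially. (5 / 8 * real n * ((real n)\<^sup>2 - 1)\<^sup>2 - 10 * real n ^ 4) / ?b n
      \<le> max_density 5 4 n"
    using eventually_ge_at_top[of 5]
  proof eventually_elim
    case (elim n)
    show ?case
      using max_density_ge[of n] pos[OF elim] unfolding binomial5
          by (simp add: pos_divide_le_eq mult.commute)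
  qed
  show "\<forall>\<^sub>F n in sequentially. max_density 5 4 n \<le> (5 / 8 * real n ^ 5) / ?b n"
    using eventually_ge_at_top[of 5]
  proof eventually_elim
    case (elim n)
    show ?case
      using max_density_le[of n] pos[OF elim] unfolding binomial5
          by (simp add: pos_le_divide_eq mult.commute)
  qed
  show "(\<lambda>n. (5 / 8 * real n * ((real n)\<^sup>2 - 1)\<^sup>2 - 10 * real n ^ 4) / ?b n) \<longlonglongrightarrow> 5 / 8"
    by real_asymp
  show "(\<lambda>n. (5 / 8 * real n ^ 5) / ?b n) \<longlonglongrightarrow> 5 / 8"
    by real_asymp
qed

section \<open>Perfect stability\<close>

text \<open>
  Here \<open>m\<close> is the imbalance, \<open>T\<close> the number of bad triples, \<open>W\<close> the number of wrong pairs, \<open>N\<close> and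
  \<open>P\<close> count the 5-tuples of the graph without and with repetition, and \<open>M\<close> is the maximum of \<open>N\<close>.
\<close>

lemma stability_arithmetic:
  fixes n m T W N P M :: real and K L :: real
  defines "\<epsilon> \<equiv> 120 / (16 * K\<^sup>2 * (K + 1)) / 384"
  assumes K: "K \<ge> 1" and L: "L \<ge> 1"
    and n: "n \<ge> 1" "n \<ge> 4 * L" "n \<ge> 2160 / (192 * \<epsilon>)"
    and m: "0 \<le> m" "m \<le> n" and W: "0 \<le> W" "W \<le> n\<^sup>2" "n * W \<le> T"
    and main: "192 * N + n\<^sup>2 * T \<le> 192 * M + (L + K * m) * n\<^sup>2 * W"
    and NP: "N \<le> P"
    and upper: "192 * P + n\<^sup>2 * T \<le> 120 * n ^ 5"
    and compare: "192 * P + n\<^sup>2 * T \<le> 120 * n * (n\<^sup>2 - m\<^sup>2)\<^sup>2 + K * m * n\<^sup>2 * W"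
    and M: "5 / 8 * n * (n\<^sup>2 - 1)\<^sup>2 - 10 * n ^ 4 \<le> M"
  shows "n ^ 3 * W \<le> max 384 (1 / \<epsilon>) * (M - N)"
proof (cases "L + K * m \<le> n / 2")
  case True
  \<comment> \<open>The error is at most half of the gain \<open>n^2 T\<close>; the other half gives
    the factor \<open>384 = 2 * 192\<close>.\<close>
  have "(L + K * m) * (n\<^sup>2 * W) \<le> n / 2 * (n\<^sup>2 * W)"
    using True W by (intro mult_right_mono) auto
  also have "\<dots> = n\<^sup>2 / 2 * (n * W)" by simp
  also have "\<dots> \<le> n\<^sup>2 / 2 * T"
    using W by (intro mult_left_mono) auto
  finally have 1: "n\<^sup>2 * T \<le> 384 * (M - N)"
    using main by (simp add: mult.assoc)
  have "n ^ 3 * W = n\<^sup>2 * (n * W)"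
    by (simp add: power2_eq_square power3_eq_cube)
  also have "\<dots> \<le> n\<^sup>2 * T"
    using W by (intro mult_left_mono) auto
  finally have 2: "n ^ 3 * W \<le> 384 * (M - N)" using 1 by simp
  moreover have "0 \<le> n ^ 3 * W" using n W by simp
  ultimately have "0 \<le> M - N" by simp
  then have "384 * (M - N) \<le> max 384 (1 / \<epsilon>) * (M - N)"
    by (intro mult_right_mono) auto
  with 2 show ?thesis by simp
next
  case False
  have eps: "0 < \<epsilon>" using K by (simp add: \<epsilon>_def)
  \<comment> \<open>Since \<open>L\<close> is at most \<open>n / 4\<close>, the imbalance is linear
    in \<open>n\<close>.\<close>
  have "n / 4 \<le> K * m" using False n by linarith
  then have mn: "n / (4 * K) \<le> m" using K by (simp add: field_simps)
  then have "(n / (4 * K))\<^sup>2 \<le> m\<^sup>2" using n K by (intro power_mono) auto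
  then have m2: "n\<^sup>2 / (16 * K\<^sup>2) \<le> m\<^sup>2" by (simp add: power_divide power_mult_distrib)
  have "K * m * n\<^sup>2 * W = K * n * m * (n * W)" by (simp add: power2_eq_square)
  also have "\<dots> \<le> K * n * n * T"
    using K n m W by (intro mult_mono) auto
  finally have a: "192 * P \<le> 120 * n * (n\<^sup>2 - m\<^sup>2)\<^sup>2 + (K - 1) * (n\<^sup>2 * T)"
    using compare by (simp add: algebra_simps power2_eq_square)
  have T: "0 \<le> n\<^sup>2 * T" using W n by (meson mult_nonneg_nonneg order_trans zero_le_power2 zero_le_one)
  have b: "K * (192 * P + n\<^sup>2 * T) \<le> K * (120 * n ^ 5)"
    using upper K by (intro mult_left_mono) auto
  have "(n\<^sup>2 - m\<^sup>2)\<^sup>2 = (n\<^sup>2 - m\<^sup>2) * (n\<^sup>2 - m\<^sup>2)" by (simp add: power2_eq_square)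
  also have "\<dots> \<le> n\<^sup>2 * (n\<^sup>2 - m\<^sup>2)"
    using m by (intro mult_right_mono) (auto simp: power_mono)
  also have "\<dots> \<le> n\<^sup>2 * (n\<^sup>2 - n\<^sup>2 / (16 * K\<^sup>2))"
    using m2 by (intro mult_left_mono) auto
  finally have "120 * n * (n\<^sup>2 - m\<^sup>2)\<^sup>2 \<le> 120 * n * (n\<^sup>2 * (n\<^sup>2 - n\<^sup>2 / (16 * K\<^sup>2)))"
    using n by (intro mult_left_mono) auto
  also have "\<dots> = 120 * n ^ 5 - 120 * n ^ 5 / (16 * K\<^sup>2)"
    by (simp add: algebra_simps eval_nat_numeral)
  finally have le: "(K + 1) * (192 * P) \<le> (K + 1) * (120 * n ^ 5) - 120 * n ^ 5 / (16 * K\<^sup>2)"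
    using a b T by (simp add: algebra_simps)
  \<comment> \<open>The loss is \<open>384 * \<epsilon> * n ^ 5\<close>. Half of it absorbs the
    lower-order terms of \<open>M\<close>, where \<open>2160 = 192 * 10 + 240\<close>; the rest
    gives \<open>\<epsilon> * n ^ 5 \<le> M - N\<close>, and the trivial bound on \<open>W\<close>
    suffices.\<close>
  have "384 * \<epsilon> = 120 / (16 * K\<^sup>2) / (K + 1)"
    unfolding \<epsilon>_def divide_divide_eq_left by simp
  then have "384 * \<epsilon> * (K + 1) = 120 / (16 * K\<^sup>2)"
    using K by (subst (asm) nonzero_eq_divide_eq) auto
  then have eq: "120 * n ^ 5 / (16 * K\<^sup>2) = (K + 1) * (384 * \<epsilon> * n ^ 5)"
    by (metis mult.assoc mult.commute times_divide_eq_left)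
  have "(K + 1) * (192 * P) \<le> (K + 1) * (120 * n ^ 5 - 384 * \<epsilon> * n ^ 5)"
    using le unfolding eq by (simp only: right_diff_distrib)
  then have P: "192 * P \<le> 120 * n ^ 5 - 384 * \<epsilon> * n ^ 5"
    using K by simp
  have "2160 \<le> n * (192 * \<epsilon>)"
    using n(3) eps by (simp add: pos_divide_le_eq mult_ac)
  then have "2160 * n ^ 4 \<le> n * (192 * \<epsilon>) * n ^ 4"
    using n by (intro mult_right_mono) auto
  then have e: "2160 * n ^ 4 \<le> 192 * \<epsilon> * n ^ 5"
    by (simp add: eval_nat_numeral mult_ac)
  have "240 * n ^ 3 \<le> 240 * n ^ 4"
    using n by (intro mult_left_mono power_increasing) auto
  moreover have "192 * (5 / 8 * n * (n\<^sup>2 - 1)\<^sup>2) = 120 * n ^ 5 - 240 * n ^ 3 + 120 * n"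
    by (simp add: algebra_simps eval_nat_numeral)
  ultimately have "120 * n ^ 5 - 2160 * n ^ 4 \<le> 192 * M"
    using M n by simp
  with P e NP have "\<epsilon> * n ^ 5 \<le> M - N" by linarith
  moreover have "n ^ 3 * W \<le> n ^ 5"
    using mult_left_mono[OF W(2), of "n ^ 3"] n by (simp add: power_add[symmetric])
  ultimately have "\<epsilon> * (n ^ 3 * W) \<le> M - N"
    using eps by (meson mult_left_mono less_imp_le order_trans)
  then have "n ^ 3 * W \<le> 1 / \<epsilon> * (M - N)"
    using eps by (simp add: pos_le_divide_eq mult_ac)
  moreover have "0 \<le> M - N"
    using \<open>\<epsilon> * n ^ 5 \<le> M - N\<close> eps n by (meson mult_nonneg_nonneg less_imp_le order_trans zero_le_power zero_le_one)
  then have "1 / \<epsilon> * (M - N) \<le> max 384 (1 / \<epsilon>) * (M - N)"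
    by (intro mult_right_mono) auto
  ultimately show ?thesis by simp
qed

text \<open>The identity map to the two cliques on the sides of \<open>s\<close> is used. Each
  differing edge comes from a wrong ordered pair, so its two orientations need not be
  tracked.\<close>

lemma edit_dist_two_cliques_le:
  fixes G :: "'a graph"
  assumes G: "simple_graph G"
  shows "int (edit_dist_blowups G two_loops)
      \<le> wrong_count (verts G) (\<lambda>x y. adj_eq G x y \<noteq> (s x = (s y :: bool)))"
proof -
  define D where "D x y \<longleftrightarrow> adj_eq G x y \<noteq> (s x = s y)" for x y
  define V where "V i = {x \<in> verts G. s x = (i = 0)}" for i :: nat
  define H where "H = blowup two_loops V"
  have fin: "finite (verts G)" using G by (simp add: simple_graph_def)
  have V: "valid_parts two_loops V"
    using fin by (auto simp: valid_parts_def V_def disjoint_family_on_def graph_on_def)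
  have vH: "verts H = verts G"
    unfolding H_def verts_two_clique[OF V] by (auto simp: V_def)
  have sH: "simple_graph H" unfolding H_def by (rule simple_graph_two_clique[OF V])
  have V01: "V 0 \<union> V 1 = verts G" by (auto simp: V_def)
  have aH: "adj_eq H x y \<longleftrightarrow> s x = s y" if "x \<in> verts G" "y \<in> verts G" for x y
    using adj_eq_two_clique[OF V, of x y] that unfolding V01 H_def[symmetric] by (simp add: V_def)
  define P where "P = {p \<in> verts G \<times> verts G. D (fst p) (snd p)}"
  have "sym_diff (edges G) (edges H) \<subseteq> (\<lambda>p. {fst p, snd p}) ` P"
  proof
    fix e assume e: "e \<in> sym_diff (edges G) (edges H)"
    then have e2: "card e = 2" "e \<subseteq> verts G"
      using G sH unfolding simple_graph_def vH by blast+
    from e2(1) obtain x y where xy: "e = {x, y}" "x \<noteq> y"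
      by (meson card_2_iff)
    with e2(2) have xyG: "x \<in> verts G" "y \<in> verts G"
      by simp_all
    have "adj_eq G x y \<noteq> adj_eq H x y"
      using e xy(2) unfolding adj_eq_def xy(1) by blast
    then have "D x y" using aH[OF xyG] by (simp add: D_def)
    then show "e \<in> (\<lambda>p. {fst p, snd p}) ` P"
      unfolding xy(1) using xyG by (intro image_eqI[of _ _ "(x, y)"]) (simp_all add: P_def)
  qed
  then have "card (sym_diff (edges G) (edges H)) \<le> card ((\<lambda>p. {fst p, snd p}) ` P)"
    using fin by (intro card_mono) (auto simp: P_def)
  also have "\<dots> \<le> card P"
    using fin by (intro card_image_le) (auto simp: P_def)
  finally have c: "card (sym_diff (edges G) (edges H)) \<le> card P" .
  have "int (card P) = (\<Sum>p\<in>verts G \<times> verts G. of_bool (D (fst p) (snd p)))"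
    using fin by (simp add: P_def Int_def)
  also have "\<dots> = wrong_count (verts G) D"
    unfolding wrong_count_def sum.cartesian_product by (simp add: case_prod_unfold)
  finally have P: "int (card P) = wrong_count (verts G) D" .
  have "edit_dist G H \<le> card (sym_diff (edges G) (edges H))"
    unfolding edit_dist_def by (rule Least_le) (intro exI[of _ "\<lambda>x. x"] conjI;
        simp add: vH bij_betw_def)
  moreover have "edit_dist_blowups G two_loops \<le> edit_dist G H"
    unfolding edit_dist_blowups_def
  proof (rule Least_le, intro exI[of _ H] conjI)
    show "H \<in> blowups two_loops"
      unfolding blowups_def H_def using V by blast
    show "card (verts H) = card (verts G)"
      by (simp only: vH)
  qed (rule refl)
  ultimately have "int (edit_dist_blowups G two_loops) \<le> wrong_count (verts G) D"
    using c P by linarith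
  then show ?thesis by (simp only: D_def[abs_def])
qed

lemma wrong_count_nonneg: "0 \<le> wrong_count V D"
  by (simp add: wrong_count_def sum_nonneg)

lemma wrong_count_le_square: "wrong_count V D \<le> (int (card V))\<^sup>2"
proof -
  have "wrong_count V D \<le> (\<Sum>x\<in>V. \<Sum>y\<in>V. 1)"
    unfolding wrong_count_def by (intro sum_mono) simp
  then show ?thesis by (simp add: power2_eq_square)
qed

lemma perfectly_stable_two_cliques: "perfectly_stable 5 4 two_loops"
proof -
  \<comment> \<open>\<open>K\<close> and \<open>L\<close> are the error factors of
    \<open>tuple_count_compare\<close>. The constant \<open>C\<close> covers both the factor and the
    lower bounds on \<open>n\<close> in \<open>stability_arithmetic\<close>.\<close>
  define K :: real where "K = 17280"
  define L :: real where "L = 11520"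
  define \<epsilon> where "\<epsilon> = 120 / (16 * K\<^sup>2 * (K + 1)) / 384"
  define C where "C = max (max 384 (1 / \<epsilon>)) (max (4 * L) (2160 / (192 * \<epsilon>)))"
  have C: "C \<ge> 384" "C \<ge> 4 * L" "C \<ge> 2160 / (192 * \<epsilon>)" "C \<ge> max 384 (1 / \<epsilon>)"
    by (simp_all add: C_def)
  have "real (edit_dist_blowups G two_loops)
      \<le> C * (max_density 5 4 (card (verts G)) - density 5 4 G) * (real (card (verts G)))\<^sup>2"
    if G: "simple_graph G" and nC: "real (card (verts G)) \<ge> C" for G :: "nat graph"
  proof -
    define V where "V = verts G"
    define r where "r = adj_eq G"
    define n where "n = real (card V)"
    have fin: "finite V" using G by (simp add: simple_graph_def V_def)
    have n: "n \<ge> C" using nC by (simp add: n_def V_def)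
    then have n1: "n \<ge> 384" using C by linarith
    then have "V \<noteq> {}" by (auto simp: n_def)
    then obtain v where "v \<in> V" and v: "int (card V) * wrong_count V (\<lambda>x y. r x y \<noteq> (r v x = r v y))
        \<le> bad_triples V r"
      by (rule exists_good_vertex[OF fin])
    define s where "s = r v"
    define h where "h x y \<longleftrightarrow> s x = s y" for x y
    define D where "D x y \<longleftrightarrow> r x y \<noteq> h x y" for x y
    define W where "W = wrong_count V D"
    define m where "m = \<bar>\<Sum>u\<in>V. sgn_of (s u)\<bar>"
    have "real_of_int (int (card V) * W) \<le> real_of_int (bad_triples V r)"
      using v unfolding of_int_le_iff W_def D_def[abs_def] h_def s_def .
    then have nW: "n * real_of_int W \<le> real_of_int (bad_triples V r)" by (simp add: n_def)
    have W2: "real_of_int W \<le> n\<^sup>2"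
    proof -
      have "real_of_int W \<le> real_of_int ((int (card V))\<^sup>2)"
        unfolding of_int_le_iff W_def by (rule wrong_count_le_square)
      then show ?thesis by (simp add: n_def)
    qed
    have m_le: "real_of_int m \<le> n"
    proof -
      have "m \<le> (\<Sum>u\<in>V. \<bar>sgn_of (s u)\<bar>)" unfolding m_def by (rule sum_abs)
      then have "m \<le> int (card V)" by simp
      then have "real_of_int m \<le> real_of_int (int (card V))" by (simp only: of_int_le_iff)
      then show ?thesis by (simp add: n_def)
    qed
    note cmp = tuple_count_compare[of V r h s D, OF fin, folded m_def W_def, unfolded r_def, OF adj_eq_refl_sym, folded r_def, OF h_def D_def]
    have "real_of_int (192 * distinct_tuple_count V r + (int (card V))\<^sup>2 * bad_triples V r)
        \<le> real_of_int (192 * distinct_tuple_count V h + (11520 + 17280 * m) * (int (card V))\<^sup>2 * W)"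
      unfolding of_int_le_iff by (rule cmp(1))
    then have main: "192 * real_of_int (distinct_tuple_count V r) + n\<^sup>2
        * real_of_int (bad_triples V r) \<le> 192 * real_of_int (distinct_tuple_count V h)
        + (L + K * real_of_int m) * n\<^sup>2 * real_of_int W"
      by (simp add: n_def L_def K_def)
    have "real_of_int (192 * tuple_count V r + (int (card V))\<^sup>2 * bad_triples V r)
        \<le> real_of_int (192 * tuple_count V h + 17280 * m * (int (card V))\<^sup>2 * W)"
      unfolding of_int_le_iff by (rule cmp(2))
    moreover have "real_of_int (8 * tuple_count V h)
        = real_of_int (5 * int (card V) * ((int (card V))\<^sup>2 - m\<^sup>2)\<^sup>2)"
      unfolding m_def power2_abs of_int_eq_iff by (rule tuple_count_two_clique_formula[OF h_def])
    ultimately have compare: "192 * real_of_int (tuple_count V r) + n\<^sup>2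
        * real_of_int (bad_triples V r) \<le> 120 * n * (n\<^sup>2 - (real_of_int m)\<^sup>2)\<^sup>2 + K * real_of_int m
        * n\<^sup>2 * real_of_int W"
      by (simp add: n_def K_def)
    have "real_of_int ((int (card V))\<^sup>2 * bad_triples V r + 192 * tuple_count V r + 10
        * square_sum V r) \<le> real_of_int (120 * int (card V) ^ 5)"
      unfolding of_int_le_iff r_def by (rule tuple_count_upper[OF adj_eq_refl_sym(2)])
    then have upper: "192 * real_of_int (tuple_count V r) + n\<^sup>2 * real_of_int (bad_triples V r)
        \<le> 120 * n ^ 5"
      using square_sum_nonneg[of V r] by (simp add: n_def)
    define M where "M = 120 * real (card V choose 5) * max_density 5 4 (card V)"
    have Mge: "5 / 8 * n * (n\<^sup>2 - 1)\<^sup>2 - 10 * n ^ 4 \<le> M"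
      unfolding M_def n_def by (rule max_density_ge)
    have c0: "real (card V choose 5) > 0"
      using n1 by (simp add: n_def)
    \<comment> \<open>The relation \<open>h\<close> is realised by an actual graph on
      \<open>V\<close>, whose count cannot exceed the maximum.\<close>
    have Ph: "real_of_int (distinct_tuple_count V h) \<le> M"
    proof -
      define U where "U i = {x \<in> V. s x = (i = 0)}" for i :: nat
      have U: "valid_parts two_loops U"
        using fin by (auto simp: valid_parts_def U_def disjoint_family_on_def graph_on_def)
      have U01: "U 0 \<union> U 1 = V" by (auto simp: U_def)
      let ?H = "blowup two_loops U"
      have "120 * int (four_edge_sets ?H) = distinct_tuple_count V (\<lambda>x y. (x \<in> U 0) = (y \<in> U 0))"
        using four_edge_sets_two_clique[OF U] unfolding U01 .
      also have "\<dots> = distinct_tuple_count V h"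
        by (rule distinct_tuple_count_cong) (simp add: U_def h_def)
      finally have "real_of_int (distinct_tuple_count V h) = 120 * real (four_edge_sets ?H)"
          by linarith
      moreover have "verts ?H = V" unfolding verts_two_clique[OF U] by (rule U01)
      moreover note density_le_max_density[OF simple_graph_two_clique[OF U], of 5 4]
      ultimately show ?thesis
        unfolding density_four_edge_sets M_def using c0 by (simp add: pos_divide_le_eq mult_ac)
    qed
    have N: "real_of_int (distinct_tuple_count V r) = 120 * real (four_edge_sets G)"
      using distinct_tuple_count_eq[OF G] unfolding V_def r_def by linarith
    have "n ^ 3 * real_of_int W \<le> max 384 (1 / \<epsilon>) * (M - real_of_int (distinct_tuple_count V r))"
      unfolding \<epsilon>_def
    proof (rule stability_arithmetic[where L = L and m = "real_of_int m" and P
        = "real_of_int (tuple_count V r)" and T = "real_of_int (bad_triples V r)"])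
      show "192 * real_of_int (distinct_tuple_count V r) + n\<^sup>2 * real_of_int (bad_triples V r) \<le> 192
          * M + (L + K * real_of_int m) * n\<^sup>2 * real_of_int W"
        using main Ph by linarith
      show "real_of_int (distinct_tuple_count V r) \<le> real_of_int (tuple_count V r)"
        by (simp add: distinct_tuple_count_le)
      show "2160 / (192 * (120 / (16 * K\<^sup>2 * (K + 1)) / 384)) \<le> n"
        using n C unfolding \<epsilon>_def by linarith
    qed (use n n1 C m_le W2 nW upper compare Mge wrong_count_nonneg[of V D] in \<open>simp_all add: K_def L_def W_def m_def\<close>)
    moreover have "0 \<le> M - real_of_int (distinct_tuple_count V r)"
    proof -
      have "density 5 4 G \<le> max_density 5 4 (card V)" unfolding V_def
          by (rule density_le_max_density[OF G])
      then show ?thesis unfolding N M_def density_four_edge_sets V_def[symmetric] using c0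
        by (simp add: pos_divide_le_eq mult_ac)
    qed
    ultimately have nW: "n ^ 3 * real_of_int W \<le> C * (M - real_of_int (distinct_tuple_count V r))"
      using C(4) mult_right_mono order_trans by blast
    have gap: "M - real_of_int (distinct_tuple_count V r) = 120 * real (card V choose 5)
        * (max_density 5 4 (card V) - density 5 4 G)"
      using c0 unfolding N M_def density_four_edge_sets V_def[symmetric]
          by (simp add: right_diff_distrib)
    have pos: "0 \<le> max_density 5 4 (card V) - density 5 4 G"
      unfolding V_def using density_le_max_density[OF G] by simp
    \<comment> \<open>Passing from \<open>120 * (n choose 5)\<close> to \<open>n ^ 5\<close> is safe
      since the density gap is nonnegative; cancelling \<open>n ^ 3\<close> then leaves the required
      \<open>n^2\<close>.\<close>
    have "C * (M - real_of_int (distinct_tuple_count V r)) \<le> C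
        * (n ^ 5 * (max_density 5 4 (card V) - density 5 4 G))"
      unfolding gap n_def using C(1) pos binomial5_le[of "card V"]
          by (intro mult_left_mono mult_right_mono) auto
    with nW have "n ^ 3 * real_of_int W \<le> n ^ 3
        * (C * (max_density 5 4 (card V) - density 5 4 G) * n\<^sup>2)"
      by (simp add: mult_ac power_add[symmetric])
    then have "real_of_int W \<le> C * (max_density 5 4 (card V) - density 5 4 G) * n\<^sup>2"
      using n1 by (simp only: mult_le_cancel_left_pos zero_less_power) 
    moreover have "int (edit_dist_blowups G two_loops) \<le> W"
      using edit_dist_two_cliques_le[OF G, of s] unfolding W_def D_def[abs_def] h_def r_def V_def .
    then have "real (edit_dist_blowups G two_loops) \<le> real_of_int W" by linarith
    ultimately show ?thesis unfolding n_def V_def by linarith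
  qed
  moreover have "C > 0" using C(1) by linarith
  ultimately show ?thesis unfolding perfectly_stable_def by blast
qed

section \<open>Limit densities of blowups\<close>

text \<open>The blowup with index \<open>n\<close> need not have exactly \<open>n\<close> vertices.
  Its order \<open>N n\<close> is only asymptotic to \<open>n\<close>, so both the count and the
  binomial coefficient are first normalised by \<open>N n ^ 5\<close>.\<close>

lemma density_two_cliques_tendsto:
  assumes V: "\<And>n. valid_parts two_loops (V n)"
    and p: "(\<lambda>n. real (card (V n 0)) / real n) \<longlonglongrightarrow> p"
    and q: "(\<lambda>n. real (card (V n 1)) / real n) \<longlonglongrightarrow> q"
    and pq: "p + q = 1"
  shows "(\<lambda>n. density 5 4 (blowup two_loops (V n))) \<longlonglongrightarrow> 5 / 8 * (1 - (p - q)\<^sup>2)\<^sup>2"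
proof -
  define a where "a n = real (card (V n 0))" for n
  define b where "b n = real (card (V n 1))" for n
  define N where "N n = a n + b n" for n
  define f where "f n = 5 / 8 * (1 - ((a n - b n) / N n)\<^sup>2)\<^sup>2" for n
  define g where "g n = 120 * real (card (verts (blowup two_loops (V n))) choose 5) / N n ^ 5" for n
  have ab: "(\<lambda>n. a n / real n) \<longlonglongrightarrow> p" "(\<lambda>n. b n / real n) \<longlonglongrightarrow> q"
    using p q by (simp_all add: a_def b_def)
  have Nn: "(\<lambda>n. N n / real n) \<longlonglongrightarrow> 1"
    using tendsto_add[OF ab] pq by (simp add: N_def add_divide_distrib)
  have N_top: "filterlim N at_top sequentially"
  proof -
    have "filterlim (\<lambda>n. N n / real n * real n) at_top sequentially"
      by (rule filterlim_tendsto_pos_mult_at_top[OF Nn]) (simp_all add: filterlim_real_sequentially)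
    moreover have "\<forall>\<^sub>F n in sequentially. N n / real n * real n = N n"
      using eventually_gt_at_top[of 0] by eventually_elim simp
    ultimately show ?thesis
      by (simp only: filterlim_cong[OF refl refl])
  qed
  have invN: "(\<lambda>n. 10 / N n) \<longlonglongrightarrow> 0"
    by (rule tendsto_divide_0[OF tendsto_const filterlim_at_top_imp_at_infinity[OF N_top]])
  have N_pos: "\<forall>\<^sub>F n in sequentially. 5 \<le> N n"
    using N_top by (simp add: filterlim_at_top)
  have "(\<lambda>n. (a n / real n - b n / real n) / (N n / real n)) \<longlonglongrightarrow> (p - q) / 1"
    by (intro tendsto_divide tendsto_diff ab Nn) simp
  moreover have "\<forall>\<^sub>F n in sequentially. (a n / real n - b n / real n) / (N n / real n)
      = (a n - b n) / N n"
    using eventually_gt_at_top[of 0] by eventually_elim (simp add: diff_divide_distrib[symmetric])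
  ultimately have "(\<lambda>n. (a n - b n) / N n) \<longlonglongrightarrow> (p - q) / 1"
    by (rule Lim_transform_eventually)
  then have "(\<lambda>n. (a n - b n) / N n) \<longlonglongrightarrow> p - q"
    by simp
  then have f: "f \<longlonglongrightarrow> 5 / 8 * (1 - (p - q)\<^sup>2)\<^sup>2"
    unfolding f_def[abs_def] by (intro tendsto_intros)
  have card: "real (card (verts (blowup two_loops (V n)))) = N n" for n
    by (simp only: card_verts_two_clique[OF V] N_def a_def b_def of_nat_add)
  have g: "g \<longlonglongrightarrow> 1"
  proof (rule tendsto_sandwich)
    show "\<forall>\<^sub>F n in sequentially. 1 - 10 / N n \<le> g n"
      using N_pos
    proof eventually_elim
      case (elim n)
      have "(1 - 10 / N n) * N n ^ 5 \<le> 120 * real (card (verts (blowup two_loops (V n))) choose 5)"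
        using binomial5_ge[of "card (verts (blowup two_loops (V n)))"] elim unfolding card
        by (simp add: left_diff_distrib eval_nat_numeral)
      then show ?case using elim by (simp add: g_def pos_le_divide_eq)
    qed
    show "\<forall>\<^sub>F n in sequentially. g n \<le> 1"
      using N_pos
    proof eventually_elim
      case (elim n)
      then show ?case
        using binomial5_le[of "card (verts (blowup two_loops (V n)))"] unfolding card g_def by simp
    qed
    show "(\<lambda>n. 1 - 10 / N n) \<longlonglongrightarrow> 1"
      using tendsto_diff[OF tendsto_const invN, of 1] by simp
  qed simp
  define c where "c n = 120 * real (four_edge_sets (blowup two_loops (V n))) / N n ^ 5" for n
  have c: "c \<longlonglongrightarrow> 5 / 8 * (1 - (p - q)\<^sup>2)\<^sup>2"
  proof (rule tendsto_sandwich)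
    have eq: "5 / 8 * N n * ((N n)\<^sup>2 - (a n - b n)\<^sup>2)\<^sup>2 = f n * N n ^ 5" if "5 \<le> N n" for n
    proof -
      have "(N n)\<^sup>2 - (a n - b n)\<^sup>2 = (1 - ((a n - b n) / N n)\<^sup>2) * (N n)\<^sup>2"
        using that by (simp add: left_diff_distrib power_divide)
      then show ?thesis
        by (simp add: f_def power_mult_distrib eval_nat_numeral)
    qed
    show "\<forall>\<^sub>F n in sequentially. c n \<le> f n"
      using N_pos
    proof eventually_elim
      case (elim n)
      then show ?case
        using four_edge_sets_two_clique_bounds(1)[OF V, of n] eq[OF elim]
        unfolding a_def[symmetric] b_def[symmetric] N_def[symmetric] c_def
        by (simp add: pos_divide_le_eq)
    qed
    show "\<forall>\<^sub>F n in sequentially. f n - 10 / N n \<le> c n"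
      using N_pos
    proof eventually_elim
      case (elim n)
      have "(f n - 10 / N n) * N n ^ 5 = f n * N n ^ 5 - 10 * N n ^ 4"
        using elim by (simp add: left_diff_distrib eval_nat_numeral)
      with elim show ?case
        using four_edge_sets_two_clique_bounds(2)[OF V, of n] eq[OF elim]
        unfolding a_def[symmetric] b_def[symmetric] N_def[symmetric] c_def
        by (simp add: pos_le_divide_eq)
    qed
    show "(\<lambda>n. f n - 10 / N n) \<longlonglongrightarrow> 5 / 8 * (1 - (p - q)\<^sup>2)\<^sup>2"
      using tendsto_diff[OF f invN] by simp
  qed (rule f)
  have "(\<lambda>n. c n / g n) \<longlonglongrightarrow> 5 / 8 * (1 - (p - q)\<^sup>2)\<^sup>2 / 1"
    by (intro tendsto_divide c g) simp
  moreover have "\<forall>\<^sub>F n in sequentially. c n / g n = density 5 4 (blowup two_loops (V n))"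
    using N_pos by eventually_elim (simp add: c_def g_def density_four_edge_sets)
  ultimately show ?thesis
    by (simp add: tendsto_cong)
qed

lemma floor_ratio_tendsto:
  assumes "0 \<le> p"
  shows "(\<lambda>n. real (nat \<lfloor>p * real n\<rfloor>) / real n) \<longlonglongrightarrow> p"
proof (rule tendsto_sandwich)
  show "\<forall>\<^sub>F n in sequentially. p - 1 / real n \<le> real (nat \<lfloor>p * real n\<rfloor>) / real n"
    using eventually_gt_at_top[of 0]
  proof eventually_elim
    case (elim n)
    have "p * real n - 1 \<le> real (nat \<lfloor>p * real n\<rfloor>)"
      by linarith
    then show ?case
      using elim by (simp add: pos_le_divide_eq left_diff_distrib)
  qed
  show "\<forall>\<^sub>F n in sequentially. real (nat \<lfloor>p * real n\<rfloor>) / real n \<le> p"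
    using eventually_gt_at_top[of 0]
  proof eventually_elim
    case (elim n)
    have "0 \<le> p * real n" using assms by simp
    then have "real (nat \<lfloor>p * real n\<rfloor>) \<le> p * real n"
      by linarith
    then show ?case
      using elim by (simp add: pos_divide_le_eq)
  qed
  show "(\<lambda>n. p - 1 / real n) \<longlonglongrightarrow> p"
    by real_asymp
qed simp

lemma blowup_density_two_cliques:
  assumes "0 \<le> p" "0 \<le> q" "p + q = 1"
  shows "blowup_density 5 4 two_loops [p, q] = 5 / 8 * (1 - (p - q)\<^sup>2)\<^sup>2"
  unfolding blowup_density_def
proof (rule the_equality)
  have verts: "(\<forall>i\<in>verts two_loops. P i) \<longleftrightarrow> P 0 \<and> P 1" for P
    by (simp add: graph_on_def numeral_2_eq_2 lessThan_Suc conj_commute)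
  let ?lim = "5 / 8 * (1 - (p - q)\<^sup>2)\<^sup>2"
  show "\<forall>V :: nat \<Rightarrow> nat \<Rightarrow> nat set. (\<forall>n. valid_parts two_loops (V n)) \<longrightarrow>
      (\<forall>i\<in>verts two_loops. (\<lambda>n. real (card (V n i)) / real n) \<longlonglongrightarrow> [p, q] ! i) \<longrightarrow>
      (\<lambda>n. density 5 4 (blowup two_loops (V n))) \<longlonglongrightarrow> ?lim"
    unfolding verts
    by (intro allI impI, elim conjE, rule density_two_cliques_tendsto[OF _ _ _ assms(3)]) simp_all
  fix L
  assume L: "\<forall>V :: nat \<Rightarrow> nat \<Rightarrow> nat set. (\<forall>n. valid_parts two_loops (V n)) \<longrightarrow>
      (\<forall>i\<in>verts two_loops. (\<lambda>n. real (card (V n i)) / real n) \<longlonglongrightarrow> [p, q] ! i) \<longrightarrow>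
      (\<lambda>n. density 5 4 (blowup two_loops (V n))) \<longlonglongrightarrow> L"
  \<comment> \<open>The definite description needs uniqueness, hence at least one admissible
    sequence of blowups; rounding down the part sizes provides it.\<close>
  define k where "k n = nat \<lfloor>p * real n\<rfloor>" for n
  define V where "V n i = (if i = 0 then {..<k n}
      else {k n..<k n + nat \<lfloor>q * real n\<rfloor>})" for n i :: nat
  have V: "valid_parts two_loops (V n)" for n
    by (auto simp: V_def valid_parts_def disjoint_family_on_def graph_on_def)
  have lims: "(\<lambda>n. real (card (V n 0)) / real n) \<longlonglongrightarrow> p" "(\<lambda>n. real (card (V n 1)) / real n) \<longlonglongrightarrow> q"
    using floor_ratio_tendsto assms by (simp_all add: V_def k_def)
  have "(\<lambda>n. density 5 4 (blowup two_loops (V n))) \<longlonglongrightarrow> L"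
    by (rule L[unfolded verts, rule_format]) (use V lims in simp_all)
  moreover have "(\<lambda>n. density 5 4 (blowup two_loops (V n))) \<longlonglongrightarrow> ?lim"
    by (rule density_two_cliques_tendsto[OF V lims assms(3)])
  ultimately show "L = ?lim"
    by (rule LIMSEQ_unique)
qed

lemma simplex_2: "simplex 2 = {[p, q] |p q. 0 \<le> p \<and> 0 \<le> q \<and> p + q = 1}"
  by (auto simp: simplex_def length_Suc_conv numeral_2_eq_2 less_Suc_eq)

lemma maximizers_two_cliques: "maximizers 5 4 two_loops = {[1 / 2, 1 / 2]}"
proof -
  let ?d = "blowup_density 5 4 two_loops"
  have half: "[1 / 2, 1 / 2] \<in> simplex 2"
    unfolding simplex_2 by (intro CollectI exI[of _ "1 / 2"]) simp
  have max: "?d [1 / 2, 1 / 2] = 5 / 8"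
    using blowup_density_two_cliques[of "1 / 2" "1 / 2"] by simp
  have "?d x \<le> 5 / 8 \<and> (?d x = 5 / 8 \<longrightarrow> x = [1 / 2, 1 / 2])" if "x \<in> simplex 2" for x
  proof -
    obtain p q where x: "x = [p, q]" and pq: "0 \<le> p" "0 \<le> q" "p + q = 1"
      using \<open>x \<in> simplex 2\<close> unfolding simplex_2 by blast
    define d where "d = (p - q)\<^sup>2"
    have d: "0 \<le> d" "d \<le> 1"
      using pq by (simp_all add: d_def abs_square_le_1)
    \<comment> \<open>A linear upper bound in \<open>d = (p - q)^2\<close>, so that the value
      \<open>5 / 8\<close> forces \<open>d = 0\<close>.\<close>
    have "(1 - d)\<^sup>2 \<le> 1 - d"
      using d by (simp add: power2_eq_square mult_left_le)
    then have le: "?d x \<le> 5 / 8 * (1 - d)"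
      unfolding x blowup_density_two_cliques[OF pq] d_def by simp
    moreover have "x = [1 / 2, 1 / 2]" if "?d x = 5 / 8"
    proof -
      have "d = 0" using le that d by simp
      then show ?thesis using pq by (simp add: x d_def)
    qed
    ultimately show ?thesis using d by fastforce
  qed
  then have "is_arg_max ?d (\<lambda>y. y \<in> simplex 2) x \<longleftrightarrow> x = [1 / 2, 1 / 2]" for x
    unfolding is_arg_max_def using half max by (metis less_le not_less)
  moreover have "card (verts two_loops) = 2"
    by (simp add: graph_on_def)
  ultimately show ?thesis
    unfolding maximizers_def by auto
qed

text \<open>Convergence is asserted together with the value because \<open>lim\<close> of a
  divergent sequence would be unspecified.\<close>

theorem theorem3p6:
  fixes B :: "nat graph"
  assumes "B = graph_on 2 {{0, 0}, {1, 1}}"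
  shows "(convergent (max_density 5 4) \<and> inducibility 5 4 = 5 / 8) \<and>
         perfectly_stable 5 4 B \<and>
         maximizers 5 4 B = {[1 / 2, 1 / 2]}"
  using max_density_tendsto perfectly_stable_two_cliques maximizers_two_cliques assms
  by (auto simp: convergent_def inducibility_def limI)

end
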